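(* Let $K$ be a field of characteristic $p>0$, $\delta:K\to K$ a derivation, and $F=\{a\in K : \delta(a)=0\}$. Suppose $\delta$ is algebraic over $F$ with minimum polynomial $g(t)=t^p-t\in F[t]$. Then for every $f(t)=t^p-t-d\in K[t;\delta]$ with $d\in K\setminus F$, the algebra $(K,\delta,d)=S_f=K[t;\delta]/K[t;\delta]f(t)$ is a unital nonassociative division algebra over $F$ of dimension $p^2$. Its left nucleus and its middle nucleus are both equal to $K$, its right nucleus contains $K$, and its automorphism group contains a cyclic subgroup of order $p$ which leaves $K$ invariant.
   Context: $K[t;\delta]$ is the differential polynomial ring: polynomials $\sum a_it^i$ with left coefficients $a_i\in K$, termwise addition, and multiplication determined by $ta=at+\delta(a)$ for $a\in K$. It has right division: for all $h,f$ with $f\neq 0$ there are unique $q,r$ with $h=qf+r$ and $\deg r<\deg f$; write $r=h \bmod_r f$. For monic $f\in K[t;\delta]$ of degree $m\ge 2$, the Petit algebra $S_f=K[t;\delta]/K[t;\delta]f$ is the $F$-vector space $\{h\in K[t;\delta] : \deg h<m\}$ with multiplication $h\circ k = hk \bmod_r f$; it is a unital, not necessarily associative $F$-algebra containing $K$ (as the constant polynomials). For a nonassociative algebra $A$ with associator $[x,y,z]=(xy)z-x(yz)$: ${\rm Nuc}_l(A)=\{x : [x,A,A]=0\}$, ${\rm Nuc}_m(A)=\{x : [A,x,A]=0\}$, ${\rm Nuc}_r(A)=\{x : [A,A,x]=0\}$ are the left, middle and right nucleus. $A\ne 0$ is a division algebra if for each $a\neq 0$ left and right multiplication by $a$ are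 bijective. *)

theory Defs
  imports
    "HOL-Computational_Algebra.Polynomial"
    "HOL-Algebra.Bij"
    "HOL-Algebra.Elementary_Groups"
    "Jordan_Normal_Form.Missing_VectorSpace"
begin

section \<open>Derivations, constants, minimum polynomials\<close>

definition derivation :: "('a::field \<Rightarrow> 'a) \<Rightarrow> bool" where
  "derivation \<delta> \<longleftrightarrow>
     (\<forall>a b. \<delta> (a + b) = \<delta> a + \<delta> b) \<and> (\<forall>a b. \<delta> (a * b) = a * \<delta> b + \<delta> a * b)"

definition constants :: "('a::field \<Rightarrow> 'a) \<Rightarrow> 'a set" where
  "constants \<delta> = {a. \<delta> a = 0}"

definition constant_field :: "('a::field \<Rightarrow> 'a) \<Rightarrow> 'a ring" where
  "constant_field \<delta> = \<lparr>carrier = constants \<delta>, mult = (*), one = 1, zero = 0, add = (+)\<rparr>"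

text \<open>The operator \<open>g(\<delta>) = \<Sum>i. g\<^sub>i \<delta>\<^sup>i\<close> on \<open>K\<close>.\<close>

definition poly_of_map :: "('a::field \<Rightarrow> 'a) \<Rightarrow> 'a poly \<Rightarrow> 'a \<Rightarrow> 'a" where
  "poly_of_map \<delta> g x = (\<Sum>i\<le>degree g. coeff g i * (\<delta> ^^ i) x)"

definition is_minimum_polynomial :: "('a::field \<Rightarrow> 'a) \<Rightarrow> 'a poly \<Rightarrow> bool" where
  "is_minimum_polynomial \<delta> g \<longleftrightarrow>
     lead_coeff g = 1 \<and> (\<forall>i. coeff g i \<in> constants \<delta>) \<and> (\<forall>x. poly_of_map \<delta> g x = 0) \<and>
     (\<forall>h. h \<noteq> 0 \<and> (\<forall>i. coeff h i \<in> constants \<delta>) \<and> (\<forall>x. poly_of_map \<delta> h x = 0)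
        \<longrightarrow> degree g \<le> degree h)"


section \<open>The differential polynomial ring\<close>

text \<open>Elements of \<open>K[t;\<delta>]\<close> are the polynomials \<open>\<Sum>i. a\<^sub>i t\<^sup>i\<close> with left coefficients, so the
  additive group of \<open>K[t;\<delta>]\<close> is that of \<^typ>\<open>'a poly\<close>; the commutative product of
  \<^typ>\<open>'a poly\<close> is not used. The rule \<open>t a = a t + \<delta>(a)\<close> makes left multiplication by \<open>t\<close> the map
  \<open>\<Sum>j. b\<^sub>j t\<^sup>j \<mapsto> \<Sum>j. b\<^sub>j t\<^sup>j\<^sup>+\<^sup>1 + \<Sum>j. \<delta>(b\<^sub>j) t\<^sup>j\<close>.\<close>

definition t_mult :: "('a::field \<Rightarrow> 'a) \<Rightarrow> 'a poly \<Rightarrow> 'a poly" where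
  "t_mult \<delta> k = pCons 0 k + map_poly \<delta> k"

definition dmult :: "('a::field \<Rightarrow> 'a) \<Rightarrow> 'a poly \<Rightarrow> 'a poly \<Rightarrow> 'a poly" where
  "dmult \<delta> h k = (\<Sum>i\<le>degree h. Polynomial.smult (coeff h i) ((t_mult \<delta> ^^ i) k))"

lemma dmult_const_left: "dmult \<delta> [:a:] k = Polynomial.smult a k"
  by (simp add: dmult_def)

lemma dmult_t_const:
  assumes "derivation \<delta>"
  shows "dmult \<delta> [:0, 1:] [:a:] = dmult \<delta> [:a:] [:0, 1:] + [:\<delta> a:]"
proof -
  have "\<delta> 0 = 0"
    using assms unfolding derivation_def by (metis add_cancel_right_right)
  then show ?thesis
    by (simp add: dmult_def t_mult_def map_poly_pCons)
qed

text \<open>Since \<open>degree 0 = 0\<close> in the library, \<open>r = 0\<close> has to be admitted separately to obtain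
  \<open>deg r < deg f\<close> with \<open>deg 0 = -\<infinity>\<close>.\<close>

definition mod_r :: "('a::field \<Rightarrow> 'a) \<Rightarrow> 'a poly \<Rightarrow> 'a poly \<Rightarrow> 'a poly" where
  "mod_r \<delta> h f = (THE r. (\<exists>q. h = dmult \<delta> q f + r) \<and> (r = 0 \<or> degree r < degree f))"


section \<open>Nonassociative algebras\<close>

text \<open>Algebras are presented as module records, whose multiplication is not assumed to be
  associative.\<close>

locale unital_algebra = vectorspace F A for F and A (structure) +
  assumes mult_closed: "\<lbrakk>x \<in> carrier A; y \<in> carrier A\<rbrakk> \<Longrightarrow> x \<otimes> y \<in> carrier A"
    and distrib_right: "\<lbrakk>x \<in> carrier A; y \<in> carrier A; z \<in> carrier A\<rbrakk>
          \<Longrightarrow> (x \<oplus> y) \<otimes> z = x \<otimes> z \<oplus> y \<otimes> z"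
    and distrib_left: "\<lbrakk>x \<in> carrier A; y \<in> carrier A; z \<in> carrier A\<rbrakk>
          \<Longrightarrow> x \<otimes> (y \<oplus> z) = x \<otimes> y \<oplus> x \<otimes> z"
    and scalar_left: "\<lbrakk>c \<in> carrier F; x \<in> carrier A; y \<in> carrier A\<rbrakk>
          \<Longrightarrow> (c \<odot> x) \<otimes> y = c \<odot> (x \<otimes> y)"
    and scalar_right: "\<lbrakk>c \<in> carrier F; x \<in> carrier A; y \<in> carrier A\<rbrakk>
          \<Longrightarrow> x \<otimes> (c \<odot> y) = c \<odot> (x \<otimes> y)"
    and unit_closed: "\<one> \<in> carrier A"
    and unit_left: "x \<in> carrier A \<Longrightarrow> \<one> \<otimes> x = x"
    and unit_right: "x \<in> carrier A \<Longrightarrow> x \<otimes> \<one> = x"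

locale unital_division_algebra = unital_algebra +
  assumes nonzero: "carrier A \<noteq> {\<zero>}"
    and left_mult_bij: "\<lbrakk>a \<in> carrier A; a \<noteq> \<zero>\<rbrakk>
          \<Longrightarrow> bij_betw (\<lambda>x. a \<otimes> x) (carrier A) (carrier A)"
    and right_mult_bij: "\<lbrakk>a \<in> carrier A; a \<noteq> \<zero>\<rbrakk>
          \<Longrightarrow> bij_betw (\<lambda>x. x \<otimes> a) (carrier A) (carrier A)"

definition associator :: "('a, 'b) ring_scheme \<Rightarrow> 'a \<Rightarrow> 'a \<Rightarrow> 'a \<Rightarrow> 'a" where
  "associator A x y z = ((x \<otimes>\<^bsub>A\<^esub> y) \<otimes>\<^bsub>A\<^esub> z) \<ominus>\<^bsub>A\<^esub> (x \<otimes>\<^bsub>A\<^esub> (y \<otimes>\<^bsub>A\<^esub> z))"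

definition left_nucleus :: "('a, 'b) ring_scheme \<Rightarrow> 'a set" where
  "left_nucleus A =
     {x \<in> carrier A. \<forall>y \<in> carrier A. \<forall>z \<in> carrier A. associator A x y z = \<zero>\<^bsub>A\<^esub>}"

definition middle_nucleus :: "('a, 'b) ring_scheme \<Rightarrow> 'a set" where
  "middle_nucleus A =
     {y \<in> carrier A. \<forall>x \<in> carrier A. \<forall>z \<in> carrier A. associator A x y z = \<zero>\<^bsub>A\<^esub>}"

definition right_nucleus :: "('a, 'b) ring_scheme \<Rightarrow> 'a set" where
  "right_nucleus A =
     {z \<in> carrier A. \<forall>x \<in> carrier A. \<forall>y \<in> carrier A. associator A x y z = \<zero>\<^bsub>A\<^esub>}"

definition algebra_auto :: "('f, 'c) ring_scheme \<Rightarrow> ('f, 'a, 'b) module_scheme \<Rightarrow> ('a \<Rightarrow> 'a) set"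
  where
  "algebra_auto F A =
     {\<phi> \<in> Bij (carrier A) \<inter> module_hom F A A.
        \<forall>x \<in> carrier A. \<forall>y \<in> carrier A. \<phi> (x \<otimes>\<^bsub>A\<^esub> y) = \<phi> x \<otimes>\<^bsub>A\<^esub> \<phi> y}"

definition Algebra_AutoGroup ::
    "('f, 'c) ring_scheme \<Rightarrow> ('f, 'a, 'b) module_scheme \<Rightarrow> ('a \<Rightarrow> 'a) monoid" where
  "Algebra_AutoGroup F A = BijGroup (carrier A) \<lparr>carrier := algebra_auto F A\<rparr>"


section \<open>Petit algebras\<close>

text \<open>For \<open>degree f \<ge> 1\<close> the carrier contains \<open>0\<close>, so \<open>degree h < degree f\<close> needs no special case.
  The scalar operation is left multiplication by constant polynomials.\<close>

definition petit_algebra :: "('a::field \<Rightarrow> 'a) \<Rightarrow> 'a poly \<Rightarrow> ('a, 'a poly) module" where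
  "petit_algebra \<delta> f =
     \<lparr>carrier = {h. degree h < degree f},
      mult = (\<lambda>h k. mod_r \<delta> (dmult \<delta> h k) f),
      one = 1, zero = 0, add = (+),
      smult = Polynomial.smult\<rparr>"

definition constant_polys :: "'a::field poly set" where
  "constant_polys = range (\<lambda>a. [:a:])"

end

theory Submission
  imports Defs "HOL-Computational_Algebra.Primes"
begin

text \<open>
  Write \<open>R = K[t;\<delta>]\<close>. In characteristic \<open>p\<close> the identity \<open>\<delta>\<^sup>p = \<delta>\<close> makes \<open>t\<^sup>p - t\<close> central in
  \<open>R\<close>, so that \<open>f z = z f + (z d - d z)\<close> for all \<open>z\<close>.

  Irreducibility of \<open>f\<close>: if \<open>f \<in> R g\<close> with \<open>0 < m = deg g < p\<close>, then \<open>g d - d g = f g - g f\<close> lies in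
  \<open>R g\<close> and has degree less than \<open>m\<close>, so it vanishes; but its coefficient at \<open>t\<^sup>m\<^sup>-\<^sup>1\<close> is
  \<open>m \<delta>(d)\<close> times the leading coefficient of \<open>g\<close>. The Euclidean algorithm turns irreducibility into the
  absence of zero divisors in \<open>S\<^sub>f\<close>.

  The minimality of \<open>t\<^sup>p - t\<close> yields \<open>u \<noteq> 0\<close> with \<open>\<delta>(u) = u\<close>. Since \<open>t\<^sup>p - t\<close> splits into distinct
  linear factors over the prime field, the powers \<open>u\<^sup>i\<close>, \<open>i < p\<close>, form an \<open>F\<close>-basis of \<open>K\<close>, and
  \<open>u\<^sup>i t\<^sup>j\<close> is an \<open>F\<close>-basis of \<open>S\<^sub>f\<close>. Multiplications by nonzero elements, being injective and
  \<open>F\<close>-linear, are therefore bijective.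

  If \<open>q\<close> is the right quotient of \<open>x y\<close> by \<open>f\<close>, then \<open>[x,y,z]\<close> is the remainder of
  \<open>- q (z d - d z)\<close>. This vanishes if one of \<open>x\<close>, \<open>y\<close>, \<open>z\<close> is in \<open>K\<close>, and it does not if
  \<open>deg x + deg y = p\<close> and \<open>z = t\<close>. Finally, the substitution \<open>t \<mapsto> t + 1\<close> is a ring automorphism of
  \<open>R\<close> that fixes \<open>K\<close> and \<open>f\<close>.
\<close>

section \<open>Derivations\<close>

locale differential_field =
  fixes \<delta> :: "'a::field \<Rightarrow> 'a"
  assumes derivation: "derivation \<delta>"
begin

lemma delta_add: "\<delta> (a + b) = \<delta> a + \<delta> b"
  and delta_mult: "\<delta> (a * b) = a * \<delta> b + \<delta> a * b"
  using derivation by (auto simp: derivation_def)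

lemma delta_0 [simp]: "\<delta> 0 = 0"
  using delta_add[of 0 0] by (metis add_0 add_cancel_left_right)

lemma delta_1 [simp]: "\<delta> 1 = 0"
  using delta_mult[of 1 1] by (metis add_cancel_left_right mult_1 mult.right_neutral)

lemma delta_minus: "\<delta> (- a) = - \<delta> a"
  using delta_add[of a "- a"] by (simp add: eq_neg_iff_add_eq_0 add.commute)

lemma delta_diff: "\<delta> (a - b) = \<delta> a - \<delta> b"
  using delta_add[of a "- b"] by (simp add: delta_minus)

lemma delta_sum: "\<delta> (sum g A) = (\<Sum>i\<in>A. \<delta> (g i))"
  by (induction A rule: infinite_finite_induct) (auto simp: delta_add)

lemma delta_of_nat [simp]: "\<delta> (of_nat n) = 0"
  by (induction n) (auto simp: delta_add)

lemma delta_inverse_const: "\<delta> a = 0 \<Longrightarrow> \<delta> (inverse a) = 0"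
  using delta_mult[of a "inverse a"] by (cases "a = 0") auto

lemma funpow_delta_const_mult: "\<delta> c = 0 \<Longrightarrow> (\<delta> ^^ n) (c * a) = c * (\<delta> ^^ n) a"
  by (induction n) (auto simp: delta_mult)

lemma funpow_delta_0 [simp]: "(\<delta> ^^ n) 0 = 0"
  by (induction n) auto

lemma funpow_delta_diff: "(\<delta> ^^ n) (a - b) = (\<delta> ^^ n) a - (\<delta> ^^ n) b"
  by (induction n) (auto simp: delta_diff)


section \<open>Arithmetic in the differential polynomial ring\<close>

abbreviation tm :: "'a poly \<Rightarrow> 'a poly" where "tm \<equiv> t_mult \<delta>"

abbreviation dm :: "'a poly \<Rightarrow> 'a poly \<Rightarrow> 'a poly"  (infixl \<open>\<bullet>\<close> 70) where
  "h \<bullet> k \<equiv> dmult \<delta> h k"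

lemma coeff_map_delta [simp]: "coeff (map_poly \<delta> k) n = \<delta> (coeff k n)"
  by (simp add: coeff_map_poly)

lemma map_delta_add: "map_poly \<delta> (k + l) = map_poly \<delta> k + map_poly \<delta> l"
  by (rule poly_eqI) (simp add: delta_add)

lemma map_delta_smult:
  "map_poly \<delta> (Polynomial.smult a k) = Polynomial.smult a (map_poly \<delta> k) + Polynomial.smult (\<delta> a) k"
  by (rule poly_eqI) (simp add: delta_mult)

lemma tm_add: "tm (k + l) = tm k + tm l"
  by (simp add: t_mult_def map_delta_add)

lemma tm_0 [simp]: "tm 0 = 0"
  by (simp add: t_mult_def)

lemma tm_smult: "tm (Polynomial.smult a k) = Polynomial.smult a (tm k) + Polynomial.smult (\<delta> a) k"
  by (simp add: t_mult_def map_delta_smult smult_add_right add.assoc)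

lemma tm_funpow_add: "(tm ^^ n) (k + l) = (tm ^^ n) k + (tm ^^ n) l"
  by (induction n) (auto simp: tm_add)

lemma tm_funpow_0 [simp]: "(tm ^^ n) 0 = 0"
  by (induction n) auto

lemma tm_funpow_smult_const:
  "\<delta> c = 0 \<Longrightarrow> (tm ^^ n) (Polynomial.smult c k) = Polynomial.smult c ((tm ^^ n) k)"
  by (induction n) (auto simp: tm_smult)

lemma smult_sum_right: "Polynomial.smult a (sum g A) = (\<Sum>i\<in>A. Polynomial.smult a (g i))"
  by (induction A rule: infinite_finite_induct) (auto simp: smult_add_right)

text \<open>A common bound \<open>n\<close> lets products with left factors of different degrees be
  added term by term.\<close>

lemma dmult_eq_sum:
  assumes "degree h \<le> n"
  shows "h \<bullet> k = (\<Sum>i\<le>n. Polynomial.smult (coeff h i) ((tm ^^ i) k))"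
  unfolding dmult_def
  by (rule sum.mono_neutral_left) (use assms in \<open>auto simp: not_le coeff_eq_0\<close>)

lemma dmult_add_left: "(h + h') \<bullet> k = h \<bullet> k + h' \<bullet> k"
proof -
  define n where "n = max (degree h) (degree h')"
  have "degree h \<le> n" "degree h' \<le> n" "degree (h + h') \<le> n"
    by (auto simp: n_def degree_add_le_max)
  then show ?thesis
    by (simp add: dmult_eq_sum smult_add_left sum.distrib)
qed

lemma dmult_smult_left: "Polynomial.smult a h \<bullet> k = Polynomial.smult a (h \<bullet> k)"
  by (simp add: dmult_eq_sum[of _ "degree h"] degree_smult_le smult_sum_right)

lemma dmult_0_left [simp]: "0 \<bullet> k = 0"
  by (simp add: dmult_def)

lemma dmult_1_left [simp]: "1 \<bullet> k = k"
  by (simp add: dmult_def)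

lemma dmult_0_right [simp]: "h \<bullet> 0 = 0"
  by (simp add: dmult_def)

lemma dmult_minus_left: "(- h) \<bullet> k = - (h \<bullet> k)"
  using dmult_smult_left[of "-1" h k] by simp

lemma dmult_diff_left: "(h - h') \<bullet> k = h \<bullet> k - h' \<bullet> k"
  using dmult_add_left[of h "- h'" k] by (simp add: dmult_minus_left)

lemma dmult_add_right: "h \<bullet> (k + l) = h \<bullet> k + h \<bullet> l"
  by (simp add: dmult_def tm_funpow_add smult_add_right sum.distrib)

lemma dmult_smult_right: "\<delta> c = 0 \<Longrightarrow> h \<bullet> Polynomial.smult c k = Polynomial.smult c (h \<bullet> k)"
  by (simp add: dmult_def tm_funpow_smult_const smult_sum_right mult.commute)

lemma dmult_minus_right: "h \<bullet> (- k) = - (h \<bullet> k)"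
  using dmult_smult_right[of "-1" h k] by (simp add: delta_minus)

lemma dmult_diff_right: "h \<bullet> (k - l) = h \<bullet> k - h \<bullet> l"
  using dmult_add_right[of h k "- l"] by (simp add: dmult_minus_right)

text \<open>Since \<open>pCons a h\<close> stands for a + h t, this is (a + h t) k = a k + h (t k).
  It drives the inductions on the left factor.\<close>

lemma dmult_pCons: "pCons a h \<bullet> k = Polynomial.smult a k + h \<bullet> tm k"
proof -
  have "pCons a h \<bullet> k = (\<Sum>i\<le>Suc (degree h). Polynomial.smult (coeff (pCons a h) i) ((tm ^^ i) k))"
    by (rule dmult_eq_sum) (rule degree_pCons_le)
  also have "\<dots> = Polynomial.smult a k + (\<Sum>i\<le>degree h. Polynomial.smult (coeff h i) ((tm ^^ i) (tm k)))"
    by (subst sum.atMost_Suc_shift) (simp add: funpow_swap1)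
  finally show ?thesis
    by (simp add: dmult_def)
qed

text \<open>Associativity for the left factor t, from which \<open>dmult_assoc\<close> follows by
  induction on the left factor.\<close>

lemma tm_dmult: "tm (k \<bullet> l) = tm k \<bullet> l"
proof (induction k arbitrary: l)
  case (pCons a k)
  \<comment> \<open>By the commutation rule, t (a + k t) = \<delta>(a) + (t k + a) t.\<close>
  have "tm (pCons a k) = pCons (\<delta> a) (tm k + [:a:])"
    by (auto simp: t_mult_def map_poly_pCons pCons_one algebra_simps)
  then show ?case
    by (simp add: dmult_pCons tm_add tm_smult pCons.IH dmult_add_left algebra_simps)
qed simp

lemma dmult_assoc: "(h \<bullet> k) \<bullet> l = h \<bullet> (k \<bullet> l)"
  by (induction h arbitrary: k)
     (auto simp: dmult_pCons dmult_add_left dmult_smult_left tm_dmult)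

lemma dmult_monom_left: "Polynomial.monom a n \<bullet> k = Polynomial.smult a ((tm ^^ n) k)"
  by (induction n arbitrary: k) (auto simp: monom_0 monom_Suc dmult_pCons funpow_swap1)

lemma coeff_tm: "coeff (tm k) n = (if n = 0 then 0 else coeff k (n - 1)) + \<delta> (coeff k n)"
  by (cases n) (auto simp: t_mult_def)

lemma degree_tm_funpow_le: "degree ((tm ^^ n) k) \<le> n + degree k"
proof (induction n)
  case (Suc n)
  show ?case
    by (rule degree_le) (use Suc in \<open>auto simp: coeff_tm coeff_eq_0\<close>)
qed simp

lemma lead_coeff_tm_funpow: "coeff ((tm ^^ n) k) (n + degree k) = lead_coeff k"
proof (induction n)
  case (Suc n)
  have "coeff ((tm ^^ n) k) (Suc (n + degree k)) = 0"
    using degree_tm_funpow_le[of n k] by (intro coeff_eq_0) auto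
  with Suc show ?case
    by (simp add: coeff_tm)
qed simp

lemma degree_dmult_le: "degree (h \<bullet> k) \<le> degree h + degree k"
  unfolding dmult_def
  by (intro degree_sum_le)
     (auto intro!: order.trans[OF degree_smult_le] order.trans[OF degree_tm_funpow_le])

text \<open>Left multiplication by t^i raises the degree by at most i and keeps the leading
  coefficient, so only the top term of \<open>h\<close> reaches this degree.\<close>

lemma lead_coeff_dmult: "coeff (h \<bullet> k) (degree h + degree k) = lead_coeff h * lead_coeff k"
proof -
  have "coeff (h \<bullet> k) (degree h + degree k)
      = (\<Sum>i\<le>degree h. coeff h i * coeff ((tm ^^ i) k) (degree h + degree k))"
    by (simp add: dmult_def coeff_sum)
  also have "\<dots> = (\<Sum>i\<in>{degree h}. coeff h i * coeff ((tm ^^ i) k) (degree h + degree k))"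
  proof (rule sum.mono_neutral_right)
    show "\<forall>i\<in>{..degree h} - {degree h}. coeff h i * coeff ((tm ^^ i) k) (degree h + degree k) = 0"
    proof
      fix i assume "i \<in> {..degree h} - {degree h}"
      then have "coeff ((tm ^^ i) k) (degree h + degree k) = 0"
        using degree_tm_funpow_le[of i k] by (intro coeff_eq_0) auto
      then show "coeff h i * coeff ((tm ^^ i) k) (degree h + degree k) = 0"
        by simp
    qed
  qed auto
  finally show ?thesis
    by (simp add: lead_coeff_tm_funpow)
qed

lemma degree_dmult:
  assumes "h \<noteq> 0" "k \<noteq> 0"
  shows "degree (h \<bullet> k) = degree h + degree k"
  using assms lead_coeff_dmult[of h k] degree_dmult_le[of h k]
  by (intro antisym le_degree) auto

lemma dmult_eq_0_iff: "h \<bullet> k = 0 \<longleftrightarrow> h = 0 \<or> k = 0"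
  using lead_coeff_dmult[of h k] by force

section \<open>Right division and remainders\<close>

lemma right_division:
  assumes "f \<noteq> 0"
  obtains q r where "h = q \<bullet> f + r" "r = 0 \<or> degree r < degree f"
proof -
  have "\<exists>q r. h = q \<bullet> f + r \<and> (r = 0 \<or> degree r < degree f)"
  proof (induction "degree h" arbitrary: h rule: less_induct)
    case less
    show ?case
    proof (cases "h = 0 \<or> degree h < degree f")
      case True
      then show ?thesis
        by (intro exI[of _ 0] exI[of _ h]) auto
    next
      case False
      \<comment> \<open>\<open>m\<close> is chosen so that \<open>m \<bullet> f\<close> has the
        leading term of \<open>h\<close>; leading coefficients multiply as in the commutative
        case.\<close>
      define m where "m = Polynomial.monom (lead_coeff h / lead_coeff f) (degree h - degree f)"
      have lm: "lead_coeff m = lead_coeff h / lead_coeff f"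
        and dm: "degree m + degree f = degree h"
        using False assms by (auto simp: m_def degree_monom_eq)
      define h' where "h' = h - m \<bullet> f"
      have "coeff h' (degree h) = 0"
        using lead_coeff_dmult[of m f] assms by (simp add: h'_def lm dm)
      moreover have "degree h' \<le> degree h"
        using degree_dmult_le[of m f] dm by (auto simp: h'_def intro: degree_diff_le)
      ultimately have "h' = 0 \<or> degree h' < degree h"
        by (metis leading_coeff_0_iff le_neq_implies_less)
      then have "\<exists>q r. h' = q \<bullet> f + r \<and> (r = 0 \<or> degree r < degree f)"
      proof
        assume "h' = 0"
        then show ?thesis
          by (intro exI[of _ 0]) simp
      qed (rule less)
      then obtain q r where qr: "h' = q \<bullet> f + r" "r = 0 \<or> degree r < degree f"
        by blast
      have "h = (m + q) \<bullet> f + r"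
        using qr(1) by (simp add: h'_def dmult_add_left algebra_simps)
      with qr(2) show ?thesis
        by blast
    qed
  qed
  with that show thesis
    by blast
qed

lemma remainder_unique:
  assumes "q \<bullet> f + r = q' \<bullet> f + r'"
    and "r = 0 \<or> degree r < degree f" "r' = 0 \<or> degree r' < degree f"
  shows "r = r'"
proof (rule ccontr)
  assume "r \<noteq> r'"
  have eq: "(q - q') \<bullet> f = r' - r"
    using assms(1) by (simp add: dmult_diff_left algebra_simps)
  with \<open>r \<noteq> r'\<close> have "q - q' \<noteq> 0" "f \<noteq> 0"
    by (metis dmult_0_left right_minus_eq, metis dmult_0_right right_minus_eq)
  then have "degree f \<le> degree (r' - r)"
    using degree_dmult[of "q - q'" f] by (simp add: eq)
  moreover have "degree (r' - r) < degree f"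
    using assms(2,3) \<open>r \<noteq> r'\<close> by (auto intro: degree_diff_less)
  ultimately show False
    by simp
qed

lemma mod_r_eqI:
  assumes "h = q \<bullet> f + r" "r = 0 \<or> degree r < degree f"
  shows "mod_r \<delta> h f = r"
  unfolding mod_r_def
proof (rule the_equality)
  fix r'
  assume "(\<exists>q. h = q \<bullet> f + r') \<and> (r' = 0 \<or> degree r' < degree f)"
  then show "r' = r"
    using remainder_unique assms by metis
qed (use assms in blast)

lemma mod_r_division:
  assumes "f \<noteq> 0"
  obtains q where "h = q \<bullet> f + mod_r \<delta> h f" "mod_r \<delta> h f = 0 \<or> degree (mod_r \<delta> h f) < degree f"
  using assms right_division mod_r_eqI by metis

lemma mod_r_add:
  assumes "f \<noteq> 0"
  shows "mod_r \<delta> (h + k) f = mod_r \<delta> h f + mod_r \<delta> k f"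
proof -
  obtain q where q: "h = q \<bullet> f + mod_r \<delta> h f" "mod_r \<delta> h f = 0 \<or> degree (mod_r \<delta> h f) < degree f"
    using mod_r_division[OF assms] .
  obtain q' where q': "k = q' \<bullet> f + mod_r \<delta> k f" "mod_r \<delta> k f = 0 \<or> degree (mod_r \<delta> k f) < degree f"
    using mod_r_division[OF assms] .
  show ?thesis
  proof (rule mod_r_eqI)
    show "h + k = (q + q') \<bullet> f + (mod_r \<delta> h f + mod_r \<delta> k f)"
      by (subst q(1), subst q'(1)) (simp add: dmult_add_left algebra_simps)
  qed (use q(2) q'(2) in \<open>auto intro: degree_add_less\<close>)
qed

lemma mod_r_smult:
  assumes "f \<noteq> 0"
  shows "mod_r \<delta> (Polynomial.smult a h) f = Polynomial.smult a (mod_r \<delta> h f)"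
proof -
  obtain q where q: "h = q \<bullet> f + mod_r \<delta> h f" "mod_r \<delta> h f = 0 \<or> degree (mod_r \<delta> h f) < degree f"
    using mod_r_division[OF assms] .
  show ?thesis
  proof (rule mod_r_eqI)
    show "Polynomial.smult a h = Polynomial.smult a q \<bullet> f + Polynomial.smult a (mod_r \<delta> h f)"
      by (subst q(1)) (simp add: dmult_smult_left smult_add_right)
  qed (use q(2) in auto)
qed

lemma mod_r_diff: "f \<noteq> 0 \<Longrightarrow> mod_r \<delta> (h - k) f = mod_r \<delta> h f - mod_r \<delta> k f"
  using mod_r_add[of f h "Polynomial.smult (-1) k"] mod_r_smult[of f "-1" k] by simp

lemma mod_r_multiple: "mod_r \<delta> (q \<bullet> f) f = 0"
  by (rule mod_r_eqI[of _ q]) auto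

lemma mod_r_small: "degree h < degree f \<Longrightarrow> mod_r \<delta> h f = h"
  by (rule mod_r_eqI[of _ 0]) auto

section \<open>The substitution of t + a for t\<close>

definition shift :: "'a \<Rightarrow> 'a poly \<Rightarrow> 'a poly" where
  "shift a h = pcompose h [:a, 1:]"

lemma shift_add: "shift a (h + k) = shift a h + shift a k"
  by (simp add: shift_def pcompose_add)

lemma shift_smult: "shift a (Polynomial.smult b h) = Polynomial.smult b (shift a h)"
  by (simp add: shift_def pcompose_smult)

lemma shift_const: "shift a [:b:] = [:b:]"
  by (simp add: shift_def)

lemma shift_pCons: "shift a (pCons b h) = [:b:] + Polynomial.smult a (shift a h) + pCons 0 (shift a h)"
  by (simp add: shift_def pcompose_pCons)

lemma degree_shift [simp]: "degree (shift a h) = degree h"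
  by (simp add: shift_def degree_pcompose)

lemma shift_shift: "shift a (shift b h) = shift (a + b) h"
  by (simp add: shift_def pcompose_assoc[symmetric] pcompose_pCons add.commute)

lemma shift_0 [simp]: "shift 0 h = h"
  by (simp add: shift_def pcompose_idR)

text \<open>For a constant \<open>a\<close> the element t + a obeys the same rule as t, namely (t +
  a) b = b (t + a) + \<delta>(b), so substituting it respects products. The powers of t + a taken by
  \<open>pcompose\<close> are then also its powers in K[t;\<delta>].\<close>

lemma shift_dmult:
  assumes "\<delta> a = 0"
  shows "shift a (h \<bullet> k) = shift a h \<bullet> shift a k"
proof -
  have map: "shift a (map_poly \<delta> k) = map_poly \<delta> (shift a k)" for k
  proof (induction k)
    case (pCons b k)
    then show ?case
      by (simp add: map_poly_pCons shift_pCons map_delta_add map_delta_smult assms)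
  qed (simp add: shift_def)
  have tm: "shift a (tm k) = tm (shift a k) + Polynomial.smult a (shift a k)" for k
    by (simp add: t_mult_def shift_add shift_pCons map algebra_simps)
  show ?thesis
  proof (induction h arbitrary: k)
    case (pCons b h)
    have pC: "pCons 0 l \<bullet> m = l \<bullet> tm m" for l m
      by (simp add: dmult_pCons)
    show ?case
      by (simp add: dmult_pCons[of b h] shift_add shift_smult pCons.IH tm shift_pCons[of a b h]
          dmult_add_left dmult_add_right dmult_smult_left dmult_smult_right assms dmult_const_left pC
          algebra_simps)
  qed (simp add: shift_def)
qed

section \<open>Constant right factors and powers of t\<close>

lemma dmult_constants_right:
  assumes "\<And>i. \<delta> (coeff l i) = 0"
  shows "k \<bullet> l = k * l"
  using assms
proof (induction k arbitrary: l)
  case (pCons a k)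
  \<comment> \<open>With constant coefficients on the right no derivative term arises, so t acts as
    in the commutative ring.\<close>
  have tl: "tm l = pCons 0 l"
    by (rule poly_eqI) (simp add: t_mult_def pCons.prems)
  have "k \<bullet> pCons 0 l = k * pCons 0 l"
    by (rule pCons.IH) (simp add: coeff_pCons pCons.prems split: nat.splits)
  then show ?case
    by (simp add: dmult_pCons tl)
qed simp

text \<open>Left multiplication by t is the sum of two commuting operators, the degree shift and
  \<delta> on coefficients; this is the binomial theorem for its powers.\<close>

lemma tm_funpow_binomial:
  "(tm ^^ n) k
    = (\<Sum>i\<le>n. Polynomial.smult (of_nat (n choose i)) (Polynomial.monom 1 (n - i) * map_poly (\<delta> ^^ i) k))"
proof (induction n)
  case 0
  show ?case
    by (simp add: map_poly_id[unfolded id_def])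
next
  case (Suc n)
  define T where "T j i = Polynomial.monom 1 j * map_poly (\<delta> ^^ i) k" for i j
  let ?c = "\<lambda>m i. of_nat (m choose i) :: 'a"
  \<comment> \<open>In \<open>T j i\<close> the shift is applied j times and \<delta> i times; t
    raises one of the two indices.\<close>
  have tmT: "tm (T j i) = T (Suc j) i + T j (Suc i)" for i j
    by (rule poly_eqI) (auto simp: coeff_tm T_def coeff_monom_mult coeff_map_poly)
  have tm_sum: "tm (sum g A) = (\<Sum>i\<in>A. tm (g i))" for g and A :: "nat set"
    by (induction A rule: infinite_finite_induct) (auto simp: tm_add)
  \<comment> \<open>Pascal's rule splits each coefficient; the two resulting sums are matched with
    the two summands in \<open>tmT\<close>.\<close>
  have "(\<Sum>i\<le>Suc n. Polynomial.smult (?c (Suc n) i) (T (Suc n - i) i))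
      = T (Suc n) 0 + (\<Sum>i\<le>n. Polynomial.smult (?c n (Suc i)) (T (n - i) (Suc i)))
        + (\<Sum>i\<le>n. Polynomial.smult (?c n i) (T (n - i) (Suc i)))"
    by (subst sum.atMost_Suc_shift) (simp add: smult_add_left sum.distrib algebra_simps)
  also have "T (Suc n) 0 + (\<Sum>i\<le>n. Polynomial.smult (?c n (Suc i)) (T (n - i) (Suc i)))
      = (\<Sum>i\<le>Suc n. Polynomial.smult (?c n i) (T (Suc n - i) i))"
    by (subst sum.atMost_Suc_shift) simp
  also have "\<dots> = (\<Sum>i\<le>n. Polynomial.smult (?c n i) (T (Suc (n - i)) i))"
    by (simp add: binomial_eq_0 Suc_diff_le)
  also have "\<dots> + (\<Sum>i\<le>n. Polynomial.smult (?c n i) (T (n - i) (Suc i)))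
      = (\<Sum>i\<le>n. Polynomial.smult (?c n i) (tm (T (n - i) i)))"
    by (simp add: tmT smult_add_right sum.distrib)
  also have "\<dots> = tm (\<Sum>i\<le>n. Polynomial.smult (?c n i) (T (n - i) i))"
    by (simp add: tm_sum tm_smult)
  finally show ?case
    using Suc by (simp add: T_def)
qed

text \<open>The prime p divides the inner binomial coefficients, so only the two end terms
  survive.\<close>

lemma tm_funpow_CHAR:
  assumes "CHAR('a) = p" "p > 0"
  shows "(tm ^^ p) k = Polynomial.monom 1 p * k + map_poly (\<delta> ^^ p) k"
proof -
  have "prime p"
    using prime_CHAR_semidom[where ?'a = 'a] assms by simp
  let ?T = "\<lambda>i. Polynomial.smult (of_nat (p choose i)) (Polynomial.monom 1 (p - i) * map_poly (\<delta> ^^ i) k)"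
  have "(\<Sum>i\<le>p. ?T i) = (\<Sum>i\<in>{0, p}. ?T i)"
  proof (rule sum.mono_neutral_right)
    show "\<forall>i\<in>{..p} - {0, p}. ?T i = 0"
    proof
      fix i assume "i \<in> {..p} - {0, p}"
      then have "p dvd (p choose i)"
        using \<open>prime p\<close> by (intro dvd_choose_prime) auto
      then show "?T i = 0"
        using assms by (simp add: of_nat_eq_0_iff_char_dvd)
    qed
  qed auto
  also have "\<dots> = Polynomial.monom 1 p * k + map_poly (\<delta> ^^ p) k"
    using \<open>p > 0\<close> by (simp add: map_poly_id[unfolded id_def] id_def)
  finally show ?thesis
    by (simp add: tm_funpow_binomial)
qed

text \<open>Each further factor t adds one \<delta>(a) just below the leading term, whose
  coefficient stays \<open>a\<close>.\<close>

lemma coeff_tm_funpow_const: "coeff ((tm ^^ Suc n) [:a:]) n = of_nat (Suc n) * \<delta> a"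
proof (induction n)
  case (Suc n)
  have "coeff ((tm ^^ Suc n) [:a:]) (Suc n) = a"
    using lead_coeff_tm_funpow[of "Suc n" "[:a:]"] by simp
  with Suc show ?case
    by (simp only: funpow.simps(2)[of "Suc n"] o_apply) (simp add: coeff_tm algebra_simps)
qed (simp add: coeff_tm)

text \<open>Only the two top terms of \<open>h\<close> reach this degree. For the constant d this
  isolates the term in \<delta>(d) on which the irreducibility of f rests.\<close>

lemma coeff_dmult_const:
  assumes "degree h = Suc m"
  shows "coeff (h \<bullet> [:a:]) m = coeff h m * a + lead_coeff h * (of_nat (Suc m) * \<delta> a)"
proof -
  have "coeff (h \<bullet> [:a:]) m = (\<Sum>i\<le>Suc m. coeff h i * coeff ((tm ^^ i) [:a:]) m)"
    using assms by (simp add: dmult_def coeff_sum del: funpow.simps)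
  also have "\<dots> = (\<Sum>i\<in>{m, Suc m}. coeff h i * coeff ((tm ^^ i) [:a:]) m)"
  proof (rule sum.mono_neutral_right)
    show "\<forall>i\<in>{..Suc m} - {m, Suc m}. coeff h i * coeff ((tm ^^ i) [:a:]) m = 0"
    proof
      fix i assume "i \<in> {..Suc m} - {m, Suc m}"
      then have "coeff ((tm ^^ i) [:a:]) m = 0"
        using degree_tm_funpow_le[of i "[:a:]"] by (intro coeff_eq_0) auto
      then show "coeff h i * coeff ((tm ^^ i) [:a:]) m = 0"
        by simp
    qed
  qed auto
  also have "\<dots> = coeff h m * a + lead_coeff h * (of_nat (Suc m) * \<delta> a)"
    using lead_coeff_tm_funpow[of m "[:a:]"] coeff_tm_funpow_const[of m a] assms
    by (simp del: funpow.simps)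
  finally show ?thesis .
qed

section \<open>Operators g(\<delta>) on K\<close>

lemma poly_of_map_eq_sum:
  "degree g \<le> n \<Longrightarrow> poly_of_map \<delta> g x = (\<Sum>i\<le>n. coeff g i * (\<delta> ^^ i) x)"
  unfolding poly_of_map_def by (rule sum.mono_neutral_left) (auto simp: not_le coeff_eq_0)

lemma poly_of_map_diff: "poly_of_map \<delta> (g - h) x = poly_of_map \<delta> g x - poly_of_map \<delta> h x"
proof -
  define n where "n = max (degree g) (degree h)"
  have "degree g \<le> n" "degree h \<le> n" "degree (g - h) \<le> n"
    by (auto simp: n_def degree_diff_le_max)
  then show ?thesis
    by (simp add: poly_of_map_eq_sum left_diff_distrib sum_subtractf)
qed

lemma poly_of_map_monom: "poly_of_map \<delta> (Polynomial.monom a n) x = a * (\<delta> ^^ n) x"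
  by (simp add: poly_of_map_eq_sum[of _ n] degree_monom_le if_distrib[of "\<lambda>y. y * _"] cong: if_cong)

text \<open>A constant \<open>a\<close> commutes with \<delta>, so the operator of the product is a
  composite in which the linear factor acts on \<open>x\<close> first.\<close>

lemma poly_of_map_linear_factor:
  assumes "\<delta> a = 0"
  shows "poly_of_map \<delta> ([:- a, 1:] * g) x = poly_of_map \<delta> g (\<delta> x - a * x)"
proof -
  have "poly_of_map \<delta> (pCons 0 g) x = (\<Sum>i\<le>Suc (degree g). coeff (pCons 0 g) i * (\<delta> ^^ i) x)"
    by (rule poly_of_map_eq_sum) (rule degree_pCons_le)
  also have "\<dots> = (\<Sum>i\<le>degree g. coeff g i * (\<delta> ^^ i) (\<delta> x))"
    by (subst sum.atMost_Suc_shift) (simp add: funpow_swap1)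
  finally have "poly_of_map \<delta> (pCons 0 g) x = \<dots>" .
  moreover have "poly_of_map \<delta> (Polynomial.smult a g) x = (\<Sum>i\<le>degree g. coeff g i * (\<delta> ^^ i) (a * x))"
    by (subst poly_of_map_eq_sum[of _ "degree g"])
       (auto simp: degree_smult_le funpow_delta_const_mult[OF assms] intro!: sum.cong)
  moreover have "[:- a, 1:] * g = pCons 0 g - Polynomial.smult a g"
    by simp
  ultimately show ?thesis
    by (simp only: poly_of_map_diff)
       (simp add: poly_of_map_def funpow_delta_diff right_diff_distrib sum_subtractf)
qed

text \<open>Running the Euclidean algorithm on \<open>f\<close> and \<open>k\<close> preserves a relation \<open>h k = q f\<close>; this bounds
  the degree of the least common left multiple from below.\<close>

lemma common_right_divisor:
  assumes "h \<bullet> k = q \<bullet> f" "h \<noteq> 0" "k \<noteq> 0"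
  shows "\<exists>g s s'. k = s \<bullet> g \<and> f = s' \<bullet> g \<and> degree f \<le> degree g + degree h"
  using assms
proof (induction "degree k" arbitrary: h k q f rule: less_induct)
  case less
  have nz: "q \<noteq> 0" "f \<noteq> 0"
    using less.prems dmult_eq_0_iff by metis+
  have deg: "degree h + degree k = degree q + degree f"
    using less.prems nz degree_dmult by metis
  obtain s r where s: "f = s \<bullet> k + r" "r = 0 \<or> degree r < degree k"
    using right_division[OF less.prems(3)] .
  show ?case
  proof (cases "r = 0")
    case True
    with s deg show ?thesis
      by (intro exI[of _ k] exI[of _ 1] exI[of _ s]) auto
  next
    case False
    \<comment> \<open>Substitute f = s k + r into h k = q f.\<close>
    have "q \<bullet> r = (h - q \<bullet> s) \<bullet> k"
      using less.prems(1) s(1) by (simp add: dmult_diff_left dmult_add_right dmult_assoc)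
    \<comment> \<open>The induction hypothesis is applied with \<open>q\<close>, \<open>r\<close>,
      \<open>k\<close> in the roles of \<open>h\<close>, \<open>k\<close>, \<open>f\<close>;
      \<open>deg\<close> turns its degree bound into the one for \<open>f\<close>.\<close>
    then obtain g s1 s2 where g: "r = s1 \<bullet> g" "k = s2 \<bullet> g" "degree k \<le> degree g + degree q"
      using less.hyps[of r q "h - q \<bullet> s" k] s(2) False nz less.prems by blast
    have "f = (s \<bullet> s2 + s1) \<bullet> g"
      using s(1) g by (simp add: dmult_add_left dmult_assoc)
    with g deg show ?thesis
      by (intro exI[of _ g] exI[of _ s2] exI[of _ "s \<bullet> s2 + s1"]) auto
  qed
qed

end


section \<open>Derivations with minimum polynomial \<open>t\<^sup>p - t\<close>\<close>

locale artin_schreier_derivation = differential_field \<delta> for \<delta> :: "'a::field \<Rightarrow> 'a" +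
  fixes p :: nat
  assumes char_p: "CHAR('a) = p" and p_pos: "p > 0"
    and minpoly: "is_minimum_polynomial \<delta> (Polynomial.monom 1 p - Polynomial.monom 1 1)"
begin

lemma prime_p: "prime p"
  using prime_CHAR_semidom[where ?'a = 'a] char_p p_pos by simp

lemma p_gt_1: "p > 1"
  using prime_p prime_gt_1_nat by blast

lemma of_nat_neq_0: "0 < n \<Longrightarrow> n < p \<Longrightarrow> (of_nat n :: 'a) \<noteq> 0"
  using char_p by (auto simp: of_nat_eq_0_iff_char_dvd dest: dvd_imp_le)

lemma inj_on_of_nat: "inj_on (of_nat :: nat \<Rightarrow> 'a) {..<p}"
proof (rule linorder_inj_onI)
  fix i j assume "i < j" "i \<in> {..<p}" "j \<in> {..<p}"
  then show "(of_nat i :: 'a) \<noteq> of_nat j"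
    using of_nat_neq_0[of "j - i"] by (auto simp: of_nat_diff less_imp_diff_less)
qed auto

definition c :: "'a poly" where "c = Polynomial.monom 1 p - Polynomial.monom 1 1"

lemma coeff_c_p: "coeff c p = 1"
  using p_gt_1 by (simp add: c_def)

lemma degree_c: "degree c = p"
  using coeff_c_p p_gt_1
  by (intro antisym le_degree) (auto simp: c_def intro!: degree_diff_le degree_monom_le[THEN order.trans])

lemma delta_funpow_p: "(\<delta> ^^ p) x = \<delta> x"
proof -
  have "poly_of_map \<delta> c x = 0"
    using minpoly by (simp add: is_minimum_polynomial_def c_def)
  then show ?thesis
    by (simp add: c_def poly_of_map_diff poly_of_map_monom)
qed

lemma dmult_c: "k \<bullet> c = k * c"
  by (rule dmult_constants_right) (auto simp: c_def delta_diff)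

text \<open>The derivative terms of t^p k and t k cancel because \<delta>^p = \<delta>. Together
  with \<open>dmult_c\<close> this makes \<open>c\<close> central.\<close>

lemma c_dmult: "c \<bullet> k = k * c"
proof -
  have "(tm ^^ p) k = Polynomial.monom 1 p * k + map_poly \<delta> k"
    using tm_funpow_CHAR[OF char_p p_pos, of k] delta_funpow_p by (simp cong: map_poly_cong)
  then show ?thesis
    by (simp add: c_def dmult_diff_left dmult_monom_left algebra_simps)
       (simp add: t_mult_def monom_Suc)
qed

section \<open>An eigenvector of \<delta> and the F-basis of its powers\<close>

lemma eigenvector_exists: "\<exists>u. u \<noteq> 0 \<and> \<delta> u = u"
proof -
  \<comment> \<open>\<open>h\<close> is (t^p - t) / (t - 1). Its degree is below p, so by minimality
    h(\<delta>) has a nonzero value, and \<delta> - 1 kills that value.\<close>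
  define h :: "'a poly" where "h = (\<Sum>i\<in>{1..<p}. Polynomial.monom 1 i)"
  have coeff_h: "coeff h j = (if j \<in> {1..<p} then 1 else 0)" for j
    by (simp add: h_def coeff_sum if_distrib sum.delta' cong: if_cong)
  have "h \<noteq> 0"
    using coeff_h[of 1] p_gt_1 by auto
  moreover have "degree h \<le> p - 1"
    by (rule degree_le) (auto simp: coeff_h)
  then have "degree h < p"
    using p_pos by linarith
  moreover have "\<forall>i. coeff h i \<in> constants \<delta>"
    by (simp add: coeff_h constants_def)
  ultimately obtain x where x: "poly_of_map \<delta> h x \<noteq> 0"
    using minpoly degree_c unfolding is_minimum_polynomial_def c_def by (metis leD)
  define u where "u = poly_of_map \<delta> h x"
  have u: "u = (\<Sum>i\<in>{1..<p}. (\<delta> ^^ i) x)"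
    unfolding u_def poly_of_map_eq_sum[OF less_imp_le[OF \<open>degree h < p\<close>]]
    by (rule sum.mono_neutral_cong_right) (auto simp: coeff_h)
  have "\<delta> u = (\<Sum>i\<in>{1..<p}. (\<delta> ^^ Suc i) x)"
    by (simp add: u delta_sum)
  also have "\<dots> = (\<Sum>i\<in>{Suc 1..<Suc p}. (\<delta> ^^ i) x)"
    by (simp only: sum.shift_bounds_Suc_ivl)
  also have "\<dots> = (\<Sum>i\<in>{Suc 1..<p}. (\<delta> ^^ i) x) + (\<delta> ^^ p) x"
    using p_gt_1 by (subst sum.atLeastLessThan_Suc) auto
  \<comment> \<open>The top term \<delta>^p(x) equals \<delta>(x), the summand missing at the lower
    end.\<close>
  also have "\<dots> = u"
    using p_gt_1 by (subst u, subst (2) sum.atLeast_Suc_lessThan) (auto simp: delta_funpow_p add.commute)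
  finally show ?thesis
    using x u_def by blast
qed

text \<open>Fermat's little theorem, by induction from the additivity of the p-th power.\<close>

lemma of_nat_power_p: "(of_nat i :: 'a) ^ p = of_nat i"
proof (induction i)
  case (Suc i)
  have "(of_nat (Suc i) :: 'a) ^ p = (of_nat i + 1) ^ p"
    by (simp add: add.commute)
  also have "\<dots> = of_nat i ^ p + 1 ^ p"
    by (rule freshmans_dream) (use char_p prime_p in auto)
  finally show ?case
    using Suc by (simp add: add.commute)
qed (use p_pos in simp)

text \<open>Both sides are monic of degree p and vanish on the p elements of the prime
  field.\<close>

lemma c_eq_prod: "c = (\<Prod>i<p. [:- of_nat i, 1:])"
proof (rule poly_eqI_degree_lead_coeff[where n = p and A = "of_nat ` {..<p}"])
  let ?P = "\<Prod>i<p. [:- of_nat i, 1:] :: 'a poly"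
  have deg: "degree ?P = p"
    by (subst degree_prod_eq_sum_degree) auto
  show "degree ?P \<le> p"
    by (simp add: deg)
  have "lead_coeff ?P = 1"
    by (simp add: lead_coeff_prod)
  then show "coeff c p = coeff ?P p"
    by (simp add: deg coeff_c_p)
  show "p \<le> card (of_nat ` {..<p} :: 'a set)"
    by (simp add: card_image inj_on_of_nat)
  fix z :: 'a assume "z \<in> of_nat ` {..<p}"
  then obtain i where "i < p" "z = of_nat i"
    by auto
  then show "poly c z = poly ?P z"
    by (auto simp: c_def poly_prod poly_monom of_nat_power_p intro!: prod_zero[symmetric] bexI[of _ i])
qed (simp add: degree_c)

lemma delta_eigenvector_power: "\<delta> u = u \<Longrightarrow> \<delta> (u ^ i) = of_nat i * u ^ i"
  by (induction i) (auto simp: delta_mult algebra_simps)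

text \<open>By induction (\<delta> - k) x is a combination of the powers below u^k. The operator
  \<delta> - k multiplies u^i by i - k, which is invertible for i < k. So x is a combination of
  lower powers plus a solution of \<delta>(y) = k y, which is a constant multiple of u^k.\<close>

lemma eigenvector_powers_span_aux:
  assumes "u \<noteq> 0" "\<delta> u = u" "k \<le> p" "poly_of_map \<delta> (\<Prod>i<k. [:- of_nat i, 1:]) x = 0"
  shows "\<exists>a. (\<forall>i. \<delta> (a i) = 0) \<and> x = (\<Sum>i<k. a i * u ^ i)"
  using assms(3,4)
proof (induction k arbitrary: x)
  case 0
  \<comment> \<open>The empty product is 1, so the hypothesis says x = 0.\<close>
  then show ?case
    by (intro exI[of _ "\<lambda>_. 0"]) (simp add: poly_of_map_def)
next
  case (Suc k)
  define g :: "'a poly" where "g = (\<Prod>i<k. [:- of_nat i, 1:])"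
  have "poly_of_map \<delta> ([:- of_nat k, 1:] * g) x = 0"
    using Suc.prems(2) by (simp add: g_def mult.commute)
  then have "poly_of_map \<delta> g (\<delta> x - of_nat k * x) = 0"
    by (simp only: poly_of_map_linear_factor delta_of_nat)
  then obtain a where a: "\<And>i. \<delta> (a i) = 0" "\<delta> x - of_nat k * x = (\<Sum>i<k. a i * u ^ i)"
    using Suc.IH[of "\<delta> x - of_nat k * x"] Suc.prems(1) by (auto simp: g_def)
  \<comment> \<open>The combination with coefficients \<open>b\<close> is a preimage of (\<delta> -
    k) x under \<delta> - k.\<close>
  define b where "b i = a i * inverse (of_nat i - of_nat k)" for i
  have \<delta>b: "\<delta> (b i) = 0" for i
    using a(1) by (simp add: b_def delta_mult delta_inverse_const delta_diff)
  have b: "b i * (of_nat i - of_nat k) = a i" if "i < k" for i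
  proof -
    have "of_nat i - of_nat k \<noteq> (0 :: 'a)"
      using that Suc.prems(1) inj_onD[OF inj_on_of_nat, of i k] by auto
    then show ?thesis
      by (simp add: b_def)
  qed
  define y where "y = x - (\<Sum>i<k. b i * u ^ i)"
  have "\<delta> (b i * u ^ i) = b i * (of_nat i * u ^ i)" for i
    by (simp add: delta_mult \<delta>b delta_eigenvector_power[OF assms(2)])
  then have "\<delta> y - of_nat k * y
      = (\<delta> x - of_nat k * x) - (\<Sum>i<k. b i * (of_nat i - of_nat k) * u ^ i)"
    by (simp add: y_def delta_diff delta_sum algebra_simps sum_subtractf sum_distrib_left)
  also have "\<dots> = 0"
    using a(2) b by simp
  finally have y: "\<delta> y = of_nat k * y"
    by simp
  \<comment> \<open>Both y and u^k solve \<delta>(z) = k z, so their quotient is a constant.\<close>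
  define e where "e = y * inverse (u ^ k)"
  have ye: "y = e * u ^ k"
    using assms(1) by (simp add: e_def)
  then have "\<delta> e * u ^ k = 0"
    using y by (simp add: delta_mult delta_eigenvector_power[OF assms(2)])
  then have "\<delta> e = 0"
    using assms(1) by simp
  moreover have "x = (\<Sum>i<Suc k. (b(k := e)) i * u ^ i)"
    using ye by (simp add: y_def algebra_simps)
  ultimately show ?case
    using \<delta>b by (intro exI[of _ "b(k := e)"]) simp
qed

lemma eigenvector_powers_span:
  assumes "u \<noteq> 0" "\<delta> u = u"
  shows "\<exists>a. (\<forall>i. \<delta> (a i) = 0) \<and> x = (\<Sum>i<p. a i * u ^ i)"
proof (rule eigenvector_powers_span_aux[OF assms order.refl])
  show "poly_of_map \<delta> (\<Prod>i<p. [:- of_nat i, 1:]) x = 0"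
    using minpoly unfolding c_eq_prod[symmetric] by (simp add: is_minimum_polynomial_def c_def)
qed

text \<open>The eigenvalues are distinct: \<delta> - k annihilates the term in u^k and multiplies
  the others by the nonzero i - k.\<close>

lemma eigenvector_powers_independent:
  assumes "u \<noteq> 0" "\<delta> u = u"
    and "k \<le> p" "\<And>i. i < k \<Longrightarrow> \<delta> (a i) = 0" "(\<Sum>i<k. a i * u ^ i) = 0" "i < k"
  shows "a i = 0"
  using assms(3-6)
proof (induction k arbitrary: a i)
  case (Suc k)
  have \<delta>: "\<delta> (a i * u ^ i) = a i * (of_nat i * u ^ i)" if "i < Suc k" for i
    using that Suc.prems(2) by (simp add: delta_mult delta_eigenvector_power[OF assms(2)])
  let ?s = "\<Sum>i<Suc k. a i * u ^ i"
  have "\<delta> ?s - of_nat k * ?s = (\<Sum>i<Suc k. a i * (of_nat i - of_nat k) * u ^ i)"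
    unfolding delta_sum sum_distrib_left sum_subtractf[symmetric]
    by (rule sum.cong) (simp_all add: \<delta> algebra_simps)
  then have 0: "(\<Sum>i<k. a i * (of_nat i - of_nat k) * u ^ i) = 0"
    using Suc.prems(3) by simp
  have less: "a j = 0" if "j < k" for j
  proof -
    have "a j * (of_nat j - of_nat k) = 0"
      by (rule Suc.IH[OF _ _ 0 that]) (use Suc.prems in \<open>auto simp: delta_mult delta_diff\<close>)
    then show ?thesis
      using that Suc.prems(1) inj_onD[OF inj_on_of_nat, of j k] by auto
  qed
  then have "a k = 0"
    using Suc.prems(3) assms(1) by simp
  with less Suc.prems(4) show ?case
    by (auto simp: less_Suc_eq)
qed simp

end

section \<open>Irreducibility of f and absence of zero divisors\<close>

locale petit_setting = artin_schreier_derivation +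
  fixes d
  assumes delta_d: "\<delta> d \<noteq> 0"
begin

definition f :: "'a poly" where "f = c - [:d:]"

lemma lead_coeff_f: "coeff f p = 1"
  using p_gt_1 by (simp add: f_def coeff_c_p coeff_pCons split: nat.splits)

lemma degree_f [simp]: "degree f = p"
  using lead_coeff_f degree_c by (intro antisym le_degree) (auto simp: f_def intro!: degree_diff_le)

lemma f_nonzero [simp]: "f \<noteq> 0"
  using degree_f p_pos by (metis degree_0 less_irrefl)

text \<open>As \<open>c\<close> is central, only the constant term d can fail to commute with
  \<open>k\<close>. The bracket later measures the failure of associativity.\<close>

lemma f_dmult: "f \<bullet> k = k \<bullet> f + (k \<bullet> [:d:] - Polynomial.smult d k)"
  by (simp add: f_def dmult_diff_left dmult_diff_right dmult_c c_dmult dmult_const_left)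

lemma degree_right_divisor:
  assumes "f = q \<bullet> g" "degree g < p"
  shows "degree g = 0"
proof (cases "degree g")
  case (Suc m)
  define e where "e = g \<bullet> [:d:] - Polynomial.smult d g"
  \<comment> \<open>\<open>e\<close> is f g - g f, and f = q g makes it a left multiple of
    \<open>g\<close>.\<close>
  have e: "e = (f - g \<bullet> q) \<bullet> g"
    using f_dmult[of g] assms(1) by (simp add: e_def dmult_diff_left dmult_assoc)
  have "degree e \<le> degree g"
    using degree_dmult_le[of g "[:d:]"] by (auto simp: e_def intro!: degree_diff_le degree_smult_le)
  \<comment> \<open>In this degree both products contribute d times the leading coefficient of
    \<open>g\<close>.\<close>
  moreover have "coeff e (degree g) = 0"
    using lead_coeff_dmult[of g "[:d:]"] by (simp add: e_def mult.commute)
  ultimately have "e = 0 \<or> degree e < degree g"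
    by (metis leading_coeff_0_iff le_neq_implies_less)
  \<comment> \<open>A nonzero left multiple of \<open>g\<close> has degree at least that of
    \<open>g\<close>, which forces e = 0.\<close>
  moreover have "degree g \<le> degree e" if "e \<noteq> 0"
    using that e degree_dmult[of "f - g \<bullet> q" g] by (metis dmult_eq_0_iff le_add2)
  ultimately have "e = 0"
    by linarith
  then have "coeff e m = 0"
    by simp
  \<comment> \<open>In degree m the terms with \<open>coeff g m\<close> cancel and the derivative
    term remains; Suc m = deg g < p is invertible in K.\<close>
  then have "lead_coeff g * (of_nat (Suc m) * \<delta> d) = 0"
    using coeff_dmult_const[OF Suc, of d] by (simp add: e_def mult.commute del: of_nat_Suc)
  then have "lead_coeff g = 0"
    using delta_d of_nat_neq_0[of "Suc m"] assms(2) Suc by (simp del: of_nat_Suc)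
  then have "g = 0"
    by simp
  then show ?thesis
    by simp
qed

text \<open>A vanishing product means h k = q f, and \<open>common_right_divisor\<close> gives a
  right divisor g of k and f with p \<le> deg g + deg h. As deg g \<le> deg k < p, irreducibility
  makes g constant, against deg h < p.\<close>

lemma no_zero_divisors:
  assumes "degree h < p" "degree k < p" "mod_r \<delta> (h \<bullet> k) f = 0"
  shows "h = 0 \<or> k = 0"
proof (rule ccontr)
  assume nz: "\<not> (h = 0 \<or> k = 0)"
  obtain q where "h \<bullet> k = q \<bullet> f"
    using mod_r_division[OF f_nonzero, of "h \<bullet> k"] assms(3) by force
  then obtain g s s' where g: "k = s \<bullet> g" "f = s' \<bullet> g" "p \<le> degree g + degree h"
    using common_right_divisor[of h k q f] nz by auto
  have "degree g \<le> degree k"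
    using g(1) nz degree_dmult[of s g] by (metis dmult_eq_0_iff le_add2)
  with assms(1,2) g degree_right_divisor[OF g(2)] show False
    by simp
qed

end


section \<open>The Petit algebra\<close>

text \<open>The image of a basis is an independent set of full cardinality, hence again a basis, so
  \<open>T\<close> is onto.\<close>

lemma (in vectorspace) inj_endomorphism_bij:
  assumes "fin_dim" "T \<in> module_hom K V V" "inj_on T (carrier V)"
  shows "bij_betw T (carrier V) (carrier V)"
proof -
  interpret T: linear_map K V V T
    using assms(2) by unfold_locales
  interpret im: vectorspace K "vs T.im"
    using T.imT_is_subspace subspace_is_vs by blast
  \<comment> \<open>\<open>T\<close> is also viewed as a map onto its image, where it carries a
    basis to a basis; independence there is independence in \<open>V\<close>.\<close>
  interpret S: linear_map K V "vs T.im" T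
    using assms(2) by unfold_locales (auto simp: module_hom_def T.im_def)
  have sub: "submodule K T.im V"
    using T.imT_is_subspace by (rule is_module)
  have im_sub: "T.im \<subseteq> carrier V"
    using sub by (auto simp: submodule_def)
  obtain B where B: "finite B" "basis B"
    using finite_basis_exists assms(1) by blast
  have "im.basis (T ` B)"
    by (rule S.linear_inj_image_is_basis[OF assms(3) _ B(2) assms(1)]) (simp add: T.im_def)
  then have TB: "T ` B \<subseteq> T.im" "\<not> im.lin_dep (T ` B)"
    by (auto simp: im.basis_def)
  have "inj_on T B"
    using B(2) assms(3) by (auto simp: basis_def intro: inj_on_subset)
  then have "dim \<le> card (T ` B)"
    using dim_basis[OF B] by (simp add: card_image)
  moreover have "lin_indpt (T ` B)"
    using span_li_not_depend(2)[OF TB(1) sub] TB(2) by simp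
  ultimately have "basis (T ` B)"
    using dim_li_is_basis[OF assms(1), of "T ` B"] B(1) TB(1) im_sub by auto
  then have "carrier V \<subseteq> T.im"
    using span_is_subset[OF TB(1) sub] by (simp add: basis_def)
  with im_sub show ?thesis
    using assms(3) by (auto simp: bij_betw_def T.im_def)
qed

section \<open>The field of constants\<close>

context differential_field
begin

abbreviation F :: "'a ring" where "F \<equiv> constant_field \<delta>"

lemma constant_field_simps [simp]:
  "carrier F = {a. \<delta> a = 0}" "x \<otimes>\<^bsub>F\<^esub> y = x * y" "x \<oplus>\<^bsub>F\<^esub> y = x + y" "\<one>\<^bsub>F\<^esub> = 1" "\<zero>\<^bsub>F\<^esub> = 0"
  by (auto simp: constant_field_def constants_def)

lemma field_constant_field: "field F"
proof -
  have "cring F"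
  proof (rule cringI)
    show "abelian_group F"
      by (rule abelian_groupI)
         (auto simp: delta_add delta_minus algebra_simps intro!: exI[of _ "- _"])
    show "Group.comm_monoid F"
      by (rule comm_monoidI) (auto simp: delta_mult algebra_simps)
  qed (auto simp: algebra_simps)
  then show ?thesis
  proof (rule cring.cring_fieldI)
    show "Units F = carrier F - {\<zero>\<^bsub>F\<^esub>}"
    proof (intro equalityI subsetI)
      fix x assume "x \<in> carrier F - {\<zero>\<^bsub>F\<^esub>}"
      then show "x \<in> Units F"
        by (auto simp: Units_def delta_inverse_const intro!: exI[of _ "inverse x"])
    qed (auto simp: Units_def)
  qed
qed

end

section \<open>Algebra structure and dimension over F\<close>

context petit_setting
begin

abbreviation A :: "('a, 'a poly) module" where "A \<equiv> petit_algebra \<delta> f"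

lemma petit_algebra_simps [simp]:
  "carrier A = {h. degree h < p}" "x \<otimes>\<^bsub>A\<^esub> y = mod_r \<delta> (x \<bullet> y) f" "x \<oplus>\<^bsub>A\<^esub> y = x + y"
  "\<one>\<^bsub>A\<^esub> = 1" "\<zero>\<^bsub>A\<^esub> = 0" "a \<odot>\<^bsub>A\<^esub> x = Polynomial.smult a x"
  by (auto simp: petit_algebra_def)

lemma degree_mod_r_f: "degree (mod_r \<delta> h f) < p"
  using mod_r_division[OF f_nonzero, of h] p_pos by (metis degree_0 degree_f)

lemma vectorspace_petit: "vectorspace F A"
proof (rule vs_criteria[OF field_constant_field])
  show "\<forall>v\<in>carrier A. \<exists>neg_v\<in>carrier A. v \<oplus>\<^bsub>A\<^esub> neg_v = \<zero>\<^bsub>A\<^esub>"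
  proof
    fix v assume "v \<in> carrier A"
    then show "\<exists>neg_v\<in>carrier A. v \<oplus>\<^bsub>A\<^esub> neg_v = \<zero>\<^bsub>A\<^esub>"
      by (intro bexI[of _ "- v"]) auto
  qed
qed (use p_pos in \<open>auto simp: degree_add_less smult_add_left smult_add_right algebra_simps
      intro: le_less_trans[OF degree_smult_le]\<close>)

sublocale petit: vectorspace F A
  by (rule vectorspace_petit)

sublocale petit: unital_algebra F A
proof
  show "mult A (add A x y) z = add A (mult A x z) (mult A y z)" for x y z
    by (simp add: dmult_add_left mod_r_add)
  show "mult A x (add A y z) = add A (mult A x y) (mult A x z)" for x y z
    by (simp add: dmult_add_right mod_r_add)
  show "x \<otimes>\<^bsub>A\<^esub> \<one>\<^bsub>A\<^esub> = x" if "x \<in> carrier A" for x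
    using that by (simp add: dmult_constants_right coeff_1 if_distrib mod_r_small)
qed (auto simp: degree_mod_r_f dmult_smult_left dmult_smult_right mod_r_smult mod_r_small p_pos)

text \<open>Turns sums of the record into ordinary ones, so that coefficients can be read
  off.\<close>

lemma finsum_petit:
  "finite S \<Longrightarrow> (\<And>i. i \<in> S \<Longrightarrow> degree (g i) < p) \<Longrightarrow> finsum A g S = sum g S"
proof (induction S rule: finite_induct)
  case (insert i S)
  then show ?case
    by (subst petit.finsum_insert) auto
qed (use petit.finsum_empty in simp)

text \<open>Reading off one coefficient reduces independence and spanning in S_f to the same
  questions for the powers of u in K.\<close>

lemma coeff_sum_basis:
  assumes "j < p"
  shows "coeff (\<Sum>i<p. \<Sum>l<p. Polynomial.smult (a i l) (Polynomial.monom (u ^ i) l)) j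
    = (\<Sum>i<p. a i j * u ^ i)"
proof -
  have "(\<Sum>l<p. a i l * (if l = j then u ^ i else 0)) = a i j * u ^ i" for i
    using assms by (simp add: if_distrib[of "\<lambda>y. _ * y"] cong: if_cong)
  then show ?thesis
    by (simp add: coeff_sum)
qed

lemma petit_basis: "\<exists>B. finite B \<and> petit.basis B \<and> card B = p ^ 2"
proof -
  obtain u where u: "u \<noteq> 0" "\<delta> u = u"
    using eigenvector_exists by blast
  define b where "b = (\<lambda>(i, l). Polynomial.monom (u ^ i) l)"
  define I where "I = {..<p} \<times> {..<p}"
  define B where "B = b ` I"
  have inj: "inj_on b I"
  proof (rule inj_onI)
    fix x y assume xy: "x \<in> I" "y \<in> I" "b x = b y"
    obtain i l i' l' where eq: "x = (i, l)" "y = (i', l')"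
      by fastforce
    have "Polynomial.monom (u ^ i) l = Polynomial.monom (u ^ i') l'"
      using xy eq by (simp add: b_def)
    then have l: "l = l'" and "u ^ i = u ^ i'"
      using u by (metis degree_monom_eq power_not_zero, metis coeff_monom power_not_zero)
    \<comment> \<open>Applying \<delta> to the equality of powers compares their
      eigenvalues.\<close>
    then have "(of_nat i :: 'a) * u ^ i = of_nat i' * u ^ i"
      using delta_eigenvector_power[OF u(2)] by metis
    then have "(of_nat i :: 'a) = of_nat i'"
      using u by simp
    then have "i = i'"
      using xy eq inj_onD[OF inj_on_of_nat] by (auto simp: I_def)
    with l eq show "x = y"
      by simp
  qed
  have fin: "finite B"
    by (simp add: B_def I_def)
  have card: "card B = p ^ 2"
    by (simp add: B_def card_image[OF inj]) (simp add: I_def power2_eq_square)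
  have sub: "B \<subseteq> carrier A"
    by (auto simp: B_def I_def b_def intro!: le_less_trans[OF degree_monom_le])
  have lincomb: "petit.lincomb a B
      = (\<Sum>i<p. \<Sum>l<p. Polynomial.smult (a (b (i, l))) (Polynomial.monom (u ^ i) l))" for a
  proof -
    have "petit.lincomb a B = (\<Sum>v\<in>B. Polynomial.smult (a v) v)"
      unfolding petit.lincomb_def using fin sub
      by (subst finsum_petit) (auto intro: le_less_trans[OF degree_smult_le])
    also have "\<dots> = (\<Sum>x\<in>I. Polynomial.smult (a (b x)) (b x))"
      by (simp add: B_def sum.reindex[OF inj])
    finally show ?thesis
      by (simp add: I_def sum.cartesian_product b_def case_prod_unfold)
  qed
  have "petit.lin_indpt B"
  proof (rule petit.finite_lin_indpt2[OF fin sub])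
    fix a assume a: "a \<in> B \<rightarrow> carrier F" and 0: "petit.lincomb a B = \<zero>\<^bsub>A\<^esub>"
    have "a (b (i, l)) = 0" if il: "i < p" "l < p" for i l
    proof (rule eigenvector_powers_independent[OF u order.refl, of "\<lambda>i. a (b (i, l))" i])
      show "(\<Sum>i<p. a (b (i, l)) * u ^ i) = 0"
        using coeff_sum_basis[OF il(2), of "\<lambda>i l. a (b (i, l))" u] 0 by (simp add: lincomb)
    qed (use a il in \<open>auto simp: B_def I_def\<close>)
    then show "\<forall>v\<in>B. a v = \<zero>\<^bsub>F\<^esub>"
      by (auto simp: B_def I_def)
  qed
  moreover have "petit.gen_set B"
  proof (rule equalityI[OF petit.span_is_subset2[OF sub] subsetI])
    fix x assume x: "x \<in> carrier A"
    have "\<forall>l. \<exists>a. (\<forall>i. \<delta> (a i) = 0) \<and> coeff x l = (\<Sum>i<p. a i * u ^ i)"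
      using eigenvector_powers_span[OF u] by blast
    then obtain a where a: "\<And>l i. \<delta> (a l i) = 0" "\<And>l. coeff x l = (\<Sum>i<p. a l i * u ^ i)"
      by metis
    \<comment> \<open>Coefficients of a linear combination are indexed by vectors, so the doubly
      indexed \<open>a\<close> is transported along the inverse of \<open>b\<close>.\<close>
    define a' where "a' v = (case the_inv_into I b v of (i, l) \<Rightarrow> a l i)" for v
    have a': "a' (b (i, l)) = a l i" if "i < p" "l < p" for i l
      using that the_inv_into_f_f[OF inj, of "(i, l)"] by (simp add: a'_def I_def)
    have "petit.lincomb a' B = x"
    proof (rule poly_eqI)
      fix l
      show "coeff (petit.lincomb a' B) l = coeff x l"
      proof (cases "l < p")
        case True
        then show ?thesis
          unfolding lincomb by (simp add: coeff_sum_basis a(2) a')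
      next
        case False
        have "petit.lincomb a' B \<in> carrier A"
          by (rule petit.lincomb_closed[OF sub]) (auto simp: a'_def a(1) split: prod.splits)
        with x False show ?thesis
          by (simp add: coeff_eq_0)
      qed
    qed
    moreover have "a' \<in> B \<rightarrow> carrier F"
      by (auto simp: a'_def a(1) split: prod.splits)
    ultimately show "x \<in> petit.span B"
      unfolding petit.finite_span[OF fin sub] by blast
  qed
  ultimately show ?thesis
    using fin card sub by (auto simp: petit.basis_def)
qed

lemma petit_fin_dim: "petit.fin_dim"
  using petit_basis by (auto simp: petit.fin_dim_def petit.basis_def)

lemma petit_dim: "petit.dim = p ^ 2"
  using petit_basis petit.dim_basis by metis

section \<open>The division property\<close>

lemma petit_mult_eq_0: "x \<in> carrier A \<Longrightarrow> y \<in> carrier A \<Longrightarrow> x \<otimes>\<^bsub>A\<^esub> y = \<zero>\<^bsub>A\<^esub> \<Longrightarrow> x = 0 \<or> y = 0"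
  using no_zero_divisors by simp

lemma petit_mult_diff_left: "(x - y) \<otimes>\<^bsub>A\<^esub> z = x \<otimes>\<^bsub>A\<^esub> z - y \<otimes>\<^bsub>A\<^esub> z"
  by (simp add: dmult_diff_left mod_r_diff)

lemma petit_mult_diff_right: "x \<otimes>\<^bsub>A\<^esub> (y - z) = x \<otimes>\<^bsub>A\<^esub> y - x \<otimes>\<^bsub>A\<^esub> z"
  by (simp add: dmult_diff_right mod_r_diff)

sublocale petit: unital_division_algebra F A
proof
  show "carrier A \<noteq> {\<zero>\<^bsub>A\<^esub>}"
    using p_pos by (auto simp: set_eq_iff intro!: exI[of _ 1])
next
  fix a assume a: "a \<in> carrier A" "a \<noteq> \<zero>\<^bsub>A\<^esub>"
  show "bij_betw (\<lambda>x. a \<otimes>\<^bsub>A\<^esub> x) (carrier A) (carrier A)"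
  proof (rule petit.inj_endomorphism_bij[OF petit_fin_dim])
    show "inj_on (\<lambda>x. a \<otimes>\<^bsub>A\<^esub> x) (carrier A)"
    proof (rule inj_onI)
      fix x y assume "x \<in> carrier A" "y \<in> carrier A" "a \<otimes>\<^bsub>A\<^esub> x = a \<otimes>\<^bsub>A\<^esub> y"
      then show "x = y"
        using petit_mult_eq_0[of a "x - y"] petit_mult_diff_right[of a x y] a
        by (auto simp: degree_diff_less simp del: petit_algebra_simps(2))
    qed
  qed (use a in \<open>auto simp: module_hom_def degree_mod_r_f dmult_add_right mod_r_add
        dmult_smult_right mod_r_smult\<close>)
  show "bij_betw (\<lambda>x. x \<otimes>\<^bsub>A\<^esub> a) (carrier A) (carrier A)"
  proof (rule petit.inj_endomorphism_bij[OF petit_fin_dim])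
    show "inj_on (\<lambda>x. x \<otimes>\<^bsub>A\<^esub> a) (carrier A)"
    proof (rule inj_onI)
      fix x y assume "x \<in> carrier A" "y \<in> carrier A" "x \<otimes>\<^bsub>A\<^esub> a = y \<otimes>\<^bsub>A\<^esub> a"
      then show "x = y"
        using petit_mult_eq_0[of "x - y" a] petit_mult_diff_left[of x y a] a
        by (auto simp: degree_diff_less simp del: petit_algebra_simps(2))
    qed
  qed (use a in \<open>auto simp: module_hom_def degree_mod_r_f dmult_add_left mod_r_add
        dmult_smult_left mod_r_smult\<close>)
qed


subsection \<open>Nuclei\<close>

lemma associator_eq_0_iff:
  assumes "x \<in> carrier A" "y \<in> carrier A" "z \<in> carrier A"
  shows "associator A x y z = \<zero>\<^bsub>A\<^esub> \<longleftrightarrow> (x \<otimes>\<^bsub>A\<^esub> y) \<otimes>\<^bsub>A\<^esub> z = x \<otimes>\<^bsub>A\<^esub> (y \<otimes>\<^bsub>A\<^esub> z)"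
proof -
  \<comment> \<open>The inverse of the record is a description over the carrier, so it is identified
    with the polynomial negative only there.\<close>
  have "a_inv A h = - h" if "h \<in> carrier A" for h
    using that by (intro petit.minus_equality) auto
  then show ?thesis
    using petit.mult_closed[OF assms(1) petit.mult_closed[OF assms(2,3)]]
    by (simp add: associator_def a_minus_def)
qed

text \<open>Reducing x y drops q f, and f z = z f + (z d - d z) turns q f z into q (z d - d z)
  modulo left multiples of f. Reducing y z drops a left multiple of f, which remains one after left
  multiplication by x.\<close>

lemma associator_eq_0_iff_quotient:
  assumes "x \<in> carrier A" "y \<in> carrier A" "z \<in> carrier A"
    and q: "x \<bullet> y = q \<bullet> f + mod_r \<delta> (x \<bullet> y) f"
  shows "associator A x y z = \<zero>\<^bsub>A\<^esub> \<longleftrightarrow> mod_r \<delta> (q \<bullet> (z \<bullet> [:d:] - Polynomial.smult d z)) f = 0"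
proof -
  obtain q' where q': "y \<bullet> z = q' \<bullet> f + mod_r \<delta> (y \<bullet> z) f"
    using mod_r_division[OF f_nonzero] .
  let ?e = "z \<bullet> [:d:] - Polynomial.smult d z"
  have "mod_r \<delta> (x \<bullet> y) f \<bullet> z = x \<bullet> y \<bullet> z - (q \<bullet> z) \<bullet> f - q \<bullet> ?e"
  proof -
    have "mod_r \<delta> (x \<bullet> y) f = x \<bullet> y - q \<bullet> f"
      using q by (simp add: algebra_simps)
    then have "mod_r \<delta> (x \<bullet> y) f \<bullet> z = x \<bullet> y \<bullet> z - q \<bullet> (f \<bullet> z)"
      by (simp add: dmult_diff_left dmult_assoc)
    then show ?thesis
      by (simp only: f_dmult[of z] dmult_add_right dmult_assoc diff_diff_eq)
  qed
  then have 1: "(x \<otimes>\<^bsub>A\<^esub> y) \<otimes>\<^bsub>A\<^esub> z = mod_r \<delta> (x \<bullet> y \<bullet> z) f - mod_r \<delta> (q \<bullet> ?e) f"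
    by (simp add: mod_r_diff mod_r_multiple)
  have "x \<bullet> y \<bullet> z = (x \<bullet> q') \<bullet> f + x \<bullet> mod_r \<delta> (y \<bullet> z) f"
    unfolding dmult_assoc by (subst q') (simp add: dmult_add_right)
  then have 2: "x \<otimes>\<^bsub>A\<^esub> (y \<otimes>\<^bsub>A\<^esub> z) = mod_r \<delta> (x \<bullet> y \<bullet> z) f"
    by (simp add: mod_r_add mod_r_multiple)
  show ?thesis
    unfolding associator_eq_0_iff[OF assms(1-3)] 1 2 by simp
qed

lemma associator_small:
  assumes "x \<in> carrier A" "y \<in> carrier A" "z \<in> carrier A" "degree (x \<bullet> y) < p"
  shows "associator A x y z = \<zero>\<^bsub>A\<^esub>"
  using associator_eq_0_iff_quotient[OF assms(1-3), of 0] assms(4) p_pos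
  by (simp add: mod_r_small)

lemma associator_t_nonzero:
  assumes "x \<in> carrier A" "y \<in> carrier A" "degree x + degree y = p"
  shows "associator A x y (Polynomial.monom 1 1) \<noteq> \<zero>\<^bsub>A\<^esub>"
proof -
  obtain q where q: "x \<bullet> y = q \<bullet> f + mod_r \<delta> (x \<bullet> y) f"
    using mod_r_division[OF f_nonzero] .
  have nz: "x \<noteq> 0" "y \<noteq> 0"
    using assms by auto
  then have deg: "degree (x \<bullet> y) = p"
    using assms(3) by (simp add: degree_dmult)
  then have "q \<noteq> 0"
    using q degree_mod_r_f[of "x \<bullet> y"] by auto
  \<comment> \<open>Comparing degrees in q f = x y - r, with r the remainder, shows that q is a
    nonzero constant.\<close>
  moreover have "degree (q \<bullet> f) \<le> p"
    using deg degree_mod_r_f[of "x \<bullet> y"] degree_diff_le[of "x \<bullet> y" p "mod_r \<delta> (x \<bullet> y) f"] q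
    by (metis add_diff_cancel_right' less_imp_le order.refl)
  ultimately have "degree q = 0"
    by (simp add: degree_dmult)
  then obtain a where a: "q = [:a:]"
    by (rule degree_eq_zeroE)
  \<comment> \<open>As t d - d t = \<delta>(d), multiplying by q gives a nonzero constant, which is
    its own remainder.\<close>
  have "Polynomial.monom 1 1 \<bullet> [:d:] - Polynomial.smult d (Polynomial.monom 1 1) = [:\<delta> d:]"
    by (simp add: dmult_pCons t_mult_def map_poly_pCons monom_Suc monom_0)
  then show ?thesis
    using associator_eq_0_iff_quotient[OF assms(1,2) _ q, of "Polynomial.monom 1 1"]
      p_gt_1 p_pos delta_d \<open>q \<noteq> 0\<close> a
    by (simp add: dmult_const_left mod_r_small degree_monom_eq)
qed

lemma constant_polys_iff: "x \<in> constant_polys \<longleftrightarrow> degree x = 0"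
  by (auto simp: constant_polys_def elim: degree_eq_zeroE)

lemma left_nucleus_petit: "left_nucleus A = constant_polys"
proof (intro equalityI subsetI)
  fix x assume x: "x \<in> left_nucleus A"
  then have "degree x < p"
    by (simp add: left_nucleus_def)
  have "degree x = 0"
  proof (rule ccontr)
    assume "degree x \<noteq> 0"
    \<comment> \<open>The second factor complements the degree of \<open>x\<close> to p; it lies in
      the carrier because deg x > 0.\<close>
    with x \<open>degree x < p\<close> p_gt_1 show False
      using associator_t_nonzero[of x "Polynomial.monom 1 (p - degree x)"]
      by (auto simp: left_nucleus_def degree_monom_eq)
  qed
  then show "x \<in> constant_polys"
    by (simp add: constant_polys_iff)
next
  fix x :: "'a poly" assume "x \<in> constant_polys"
  then have "degree x = 0"
    by (simp add: constant_polys_iff)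
  then show "x \<in> left_nucleus A"
    using p_pos by (auto simp: left_nucleus_def simp flip: petit_algebra_simps(5)
        intro!: associator_small le_less_trans[OF degree_dmult_le])
qed

lemma middle_nucleus_petit: "middle_nucleus A = constant_polys"
proof (intro equalityI subsetI)
  fix x assume x: "x \<in> middle_nucleus A"
  then have "degree x < p"
    by (simp add: middle_nucleus_def)
  have "degree x = 0"
  proof (rule ccontr)
    assume "degree x \<noteq> 0"
    with x \<open>degree x < p\<close> p_gt_1 show False
      using associator_t_nonzero[of "Polynomial.monom 1 (p - degree x)" x]
      by (auto simp: middle_nucleus_def degree_monom_eq)
  qed
  then show "x \<in> constant_polys"
    by (simp add: constant_polys_iff)
next
  fix x :: "'a poly" assume "x \<in> constant_polys"
  then have "degree x = 0"
    by (simp add: constant_polys_iff)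
  then show "x \<in> middle_nucleus A"
    using p_pos by (auto simp: middle_nucleus_def simp flip: petit_algebra_simps(5)
        intro!: associator_small le_less_trans[OF degree_dmult_le])
qed

lemma constant_polys_right_nucleus: "constant_polys \<subseteq> right_nucleus A"
proof
  fix z :: "'a poly" assume "z \<in> constant_polys"
  then obtain a where z: "z = [:a:]"
    by (auto simp: constant_polys_def)
  \<comment> \<open>Elements of K commute with d, so the associator vanishes whatever the quotient
    is.\<close>
  have comm: "z \<bullet> [:d:] - Polynomial.smult d z = 0"
    by (simp add: z dmult_const_left)
  have "associator A x y z = \<zero>\<^bsub>A\<^esub>" if "x \<in> carrier A" "y \<in> carrier A" for x y
  proof -
    obtain q where q: "x \<bullet> y = q \<bullet> f + mod_r \<delta> (x \<bullet> y) f"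
      using mod_r_division[OF f_nonzero] .
    show ?thesis
      using associator_eq_0_iff_quotient[OF that _ q, of z] comm p_pos
      by (simp add: z mod_r_small)
  qed
  then show "z \<in> right_nucleus A"
    using p_pos by (simp add: right_nucleus_def z)
qed


subsection \<open>Automorphisms\<close>

text \<open>(t + j)^p - (t + j) = t^p + j^p - t - j, and j^p = j in the prime field.\<close>

lemma shift_f: "shift (of_nat j) f = f"
proof -
  have "([:of_nat j, 1:] :: 'a poly) ^ p = ([:of_nat j:] + [:0, 1:]) ^ p"
    by simp
  also have "\<dots> = [:of_nat j:] ^ p + [:0, 1:] ^ p"
    by (rule freshmans_dream) (use char_p prime_p in auto)
  also have "\<dots> = [:of_nat j:] + Polynomial.monom 1 p"
    by (simp add: poly_const_pow of_nat_power_p monom_altdef)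
  finally have pow: "([:of_nat j, 1:] :: 'a poly) ^ p = [:of_nat j:] + Polynomial.monom 1 p" .
  have pcompose_power: "pcompose (h ^ n) k = pcompose h k ^ n" for h k :: "'a poly" and n
    by (induction n) (auto simp: pcompose_mult pcompose_1)
  have "pcompose (Polynomial.monom 1 p) [:of_nat j, 1:] = ([:of_nat j, 1:] :: 'a poly) ^ p"
    by (simp add: monom_altdef pcompose_power pcompose_pCons)
  with pow show ?thesis
    by (simp add: shift_def f_def c_def pcompose_diff monom_Suc monom_0 pcompose_pCons)
qed

lemma shift_mod_r: "shift (of_nat j) (mod_r \<delta> h f) = mod_r \<delta> (shift (of_nat j) h) f"
proof -
  obtain q where q: "h = q \<bullet> f + mod_r \<delta> h f"
    using mod_r_division[OF f_nonzero] .
  have "shift (of_nat j) h = shift (of_nat j) q \<bullet> f + shift (of_nat j) (mod_r \<delta> h f)"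
    by (subst q) (simp add: shift_add shift_dmult shift_f)
  then show ?thesis
    using degree_mod_r_f by (intro mod_r_eqI[symmetric]) auto
qed

text \<open>Members of \<open>Bij\<close> are extensional, hence the restriction. Indexing by
  naturals turns composition into addition of indices, with period p.\<close>

definition \<phi> :: "nat \<Rightarrow> 'a poly \<Rightarrow> 'a poly" where
  "\<phi> j = restrict (shift (of_nat j)) (carrier A)"

lemma \<phi>_Bij: "\<phi> j \<in> Bij (carrier A)"
proof -
  have "bij_betw (shift (of_nat j)) (carrier A) (carrier A)"
    by (rule bij_betw_byWitness[of _ "shift (- of_nat j)"]) (auto simp: shift_shift)
  then show ?thesis
    by (simp add: Bij_def \<phi>_def)
qed

lemma \<phi>_automorphism: "\<phi> j \<in> algebra_auto F A"
proof -
  have "\<phi> j \<in> module_hom F A A"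
    by (auto simp: module_hom_def \<phi>_def degree_add_less shift_add shift_smult
        intro: le_less_trans[OF degree_smult_le])
  moreover have "\<phi> j (x \<otimes>\<^bsub>A\<^esub> y) = \<phi> j x \<otimes>\<^bsub>A\<^esub> \<phi> j y" if "x \<in> carrier A" "y \<in> carrier A" for x y
    using that degree_mod_r_f by (simp add: \<phi>_def shift_mod_r shift_dmult)
  ultimately show ?thesis
    using \<phi>_Bij by (simp add: algebra_auto_def)
qed

lemma \<phi>_mult: "\<phi> i \<otimes>\<^bsub>BijGroup (carrier A)\<^esub> \<phi> j = \<phi> (i + j)"
proof -
  have "compose (carrier A) (\<phi> i) (\<phi> j) = \<phi> (i + j)"
    by (auto simp: fun_eq_iff compose_def \<phi>_def shift_shift)
  then show ?thesis
    using \<phi>_Bij by (simp add: BijGroup_def)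
qed

lemma \<phi>_0: "\<phi> 0 = \<one>\<^bsub>BijGroup (carrier A)\<^esub>"
  by (auto simp: BijGroup_def \<phi>_def fun_eq_iff)

lemma \<phi>_mod: "\<phi> (j mod p) = \<phi> j"
proof -
  have "(of_nat (j mod p) :: 'a) = of_nat j"
  proof -
    have "(of_nat j :: 'a) = of_nat p * of_nat (j div p) + of_nat (j mod p)"
      by (simp flip: of_nat_mult of_nat_add)
    then show ?thesis
      using of_nat_CHAR[where ?'a = 'a] char_p by simp
  qed
  then show ?thesis
    by (simp add: \<phi>_def)
qed

lemma range_\<phi>: "range \<phi> = \<phi> ` {..<p}"
proof (intro equalityI subsetI)
  fix x assume "x \<in> range \<phi>"
  then obtain j where "x = \<phi> (j mod p)"
    using \<phi>_mod by force
  then show "x \<in> \<phi> ` {..<p}"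
    using p_pos by simp
qed auto

lemma card_range_\<phi>: "card (range \<phi>) = p"
proof -
  have "inj_on \<phi> {..<p}"
  proof (rule inj_onI)
    fix i j assume ij: "i \<in> {..<p}" "j \<in> {..<p}" "\<phi> i = \<phi> j"
    \<comment> \<open>The image t + i of t determines the map.\<close>
    then have "\<phi> i [:0, 1:] = \<phi> j [:0, 1:]"
      by simp
    then have "(of_nat i :: 'a) = of_nat j"
      using p_gt_1 by (simp add: \<phi>_def shift_def pcompose_pCons)
    with ij show "i = j"
      using inj_onD[OF inj_on_of_nat] by blast
  qed
  then show ?thesis
    by (simp add: range_\<phi> card_image)
qed

lemma \<phi>_inverse: "\<exists>i. \<phi> i \<otimes>\<^bsub>BijGroup (carrier A)\<^esub> \<phi> j = \<one>\<^bsub>BijGroup (carrier A)\<^esub>"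
proof -
  \<comment> \<open>The inverse has index (p - 1) j, since the two indices then add up to a multiple
    of p.\<close>
  have "(p - 1) * j + j = p * j"
    using p_pos by (cases p) auto
  then have "\<phi> ((p - 1) * j + j) = \<phi> 0"
    using \<phi>_mod[of "p * j"] by simp
  then show ?thesis
    using \<phi>_mult \<phi>_0 by metis
qed

lemma subgroup_range_\<phi>_BijGroup: "subgroup (range \<phi>) (BijGroup (carrier A))"
proof -
  interpret B: group "BijGroup (carrier A)"
    by (rule group_BijGroup)
  have carrier: "\<phi> j \<in> carrier (BijGroup (carrier A))" for j
    using \<phi>_Bij by (simp add: BijGroup_def)
  show ?thesis
  proof (rule B.subgroupI)
    fix x assume "x \<in> range \<phi>"
    then obtain j where x: "x = \<phi> j"
      by blast
    obtain i where "\<phi> i \<otimes>\<^bsub>BijGroup (carrier A)\<^esub> \<phi> j = \<one>\<^bsub>BijGroup (carrier A)\<^esub>"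
      using \<phi>_inverse by blast
    then have "inv\<^bsub>BijGroup (carrier A)\<^esub> x = \<phi> i"
      unfolding x by (rule B.inv_equality[OF _ carrier carrier])
    then show "inv\<^bsub>BijGroup (carrier A)\<^esub> x \<in> range \<phi>"
      by simp
  qed (use carrier \<phi>_mult in auto)
qed

text \<open>Product and unit are those of \<open>BijGroup\<close>. An inverse is a description over
  the carrier, so the inverses for the two carriers are compared through uniqueness in the larger
  group.\<close>

lemma subgroup_range_\<phi>: "subgroup (range \<phi>) (Algebra_AutoGroup F A)"
proof -
  let ?B = "BijGroup (carrier A)" and ?G = "Algebra_AutoGroup F A"
  interpret B: group ?B
    by (rule group_BijGroup)
  interpret H: subgroup "range \<phi>" ?B
    by (rule subgroup_range_\<phi>_BijGroup)
  have G: "carrier ?G = algebra_auto F A" "mult ?G = mult ?B" "one ?G = one ?B"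
    by (simp_all add: Algebra_AutoGroup_def)
  have GB: "carrier ?G \<subseteq> carrier ?B"
    by (auto simp: G algebra_auto_def BijGroup_def)
  have sub: "range \<phi> \<subseteq> carrier ?G"
    using \<phi>_automorphism G by auto
  have "inv\<^bsub>?G\<^esub> x = inv\<^bsub>?B\<^esub> x" if "x \<in> range \<phi>" for x
    unfolding m_inv_def[of ?G]
  proof (rule the_equality)
    show "inv\<^bsub>?B\<^esub> x \<in> carrier ?G \<and> x \<otimes>\<^bsub>?G\<^esub> inv\<^bsub>?B\<^esub> x = \<one>\<^bsub>?G\<^esub> \<and> inv\<^bsub>?B\<^esub> x \<otimes>\<^bsub>?G\<^esub> x = \<one>\<^bsub>?G\<^esub>"
      using that sub H.m_inv_closed[OF that] H.mem_carrier[OF that] by (auto simp: G simp del: petit_algebra_simps(1))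
    show "y = inv\<^bsub>?B\<^esub> x" if "y \<in> carrier ?G \<and> x \<otimes>\<^bsub>?G\<^esub> y = \<one>\<^bsub>?G\<^esub> \<and> y \<otimes>\<^bsub>?G\<^esub> x = \<one>\<^bsub>?G\<^esub>" for y
      using that \<open>x \<in> range \<phi>\<close> GB H.mem_carrier B.inv_equality[of y x] by (auto simp: G)
  qed
  then show ?thesis
    using sub H.m_closed H.one_closed H.m_inv_closed by (intro subgroup.intro) (auto simp: G)
qed

lemma cyclic_range_\<phi>: "cyclic_group (Algebra_AutoGroup F A \<lparr>carrier := range \<phi>\<rparr>)"
proof -
  let ?H = "BijGroup (carrier A) \<lparr>carrier := range \<phi>\<rparr>"
  have eq: "Algebra_AutoGroup F A \<lparr>carrier := range \<phi>\<rparr> = ?H"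
    by (simp add: Algebra_AutoGroup_def)
  interpret H: group ?H
    by (rule subgroup.subgroup_is_group[OF subgroup_range_\<phi>_BijGroup group_BijGroup])
  \<comment> \<open>\<open>\<phi> 1\<close> is the generator.\<close>
  have pow: "\<phi> 1 [^]\<^bsub>?H\<^esub> n = \<phi> n" for n :: nat
    by (induction n) (simp_all add: \<phi>_0 \<phi>_mult del: petit_algebra_simps(1))
  have "\<phi> 1 \<in> carrier ?H"
    by simp
  moreover have "carrier ?H = range (\<lambda>n::int. \<phi> 1 [^]\<^bsub>?H\<^esub> n)"
  proof (intro equalityI subsetI)
    fix x assume "x \<in> carrier ?H"
    then obtain n where "x = \<phi> n"
      by auto
    then have "x = \<phi> 1 [^]\<^bsub>?H\<^esub> int n"
      by (simp only: int_pow_int pow)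
    then show "x \<in> range (\<lambda>n::int. \<phi> 1 [^]\<^bsub>?H\<^esub> n)"
      by blast
  qed (use H.int_pow_closed in auto)
  ultimately have "cyclic_group ?H"
    unfolding H.cyclic_group by blast
  then show ?thesis
    by (simp only: eq)
qed

lemma \<phi>_const: "x \<in> constant_polys \<Longrightarrow> \<phi> j x = x"
  using p_pos by (auto simp: constant_polys_def \<phi>_def shift_const)

end

theorem theorem14:
  fixes \<delta> :: "'a::field \<Rightarrow> 'a" and p :: nat and d :: 'a and f :: "'a poly"
  assumes "CHAR('a) = p" and "p > 0"
    and "derivation \<delta>"
    and "is_minimum_polynomial \<delta> (Polynomial.monom 1 p - Polynomial.monom 1 1)"
    and "d \<notin> constants \<delta>"
    and "f = Polynomial.monom 1 p - Polynomial.monom 1 1 - [:d:]"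
  shows "unital_division_algebra (constant_field \<delta>) (petit_algebra \<delta> f) \<and>
    vectorspace.fin_dim (constant_field \<delta>) (petit_algebra \<delta> f) \<and>
    vectorspace.dim (constant_field \<delta>) (petit_algebra \<delta> f) = p ^ 2 \<and>
    left_nucleus (petit_algebra \<delta> f) = constant_polys \<and>
    middle_nucleus (petit_algebra \<delta> f) = constant_polys \<and>
    constant_polys \<subseteq> right_nucleus (petit_algebra \<delta> f) \<and>
    (\<exists>H. subgroup H (Algebra_AutoGroup (constant_field \<delta>) (petit_algebra \<delta> f)) \<and>
       cyclic_group
         ((Algebra_AutoGroup (constant_field \<delta>) (petit_algebra \<delta> f)) \<lparr>carrier := H\<rparr>) \<and>
       card H = p \<and>
       (\<forall>\<phi> \<in> H. \<forall>x \<in> constant_polys. \<phi> x = x))"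
proof -
  interpret P: petit_setting \<delta> p d
    using assms(1-5) by unfold_locales (auto simp: constants_def)
  have f: "f = P.f"
    using assms(6) by (simp add: P.f_def P.c_def)
  have "\<forall>\<phi>\<in>range P.\<phi>. \<forall>x\<in>constant_polys. \<phi> x = x"
    using P.\<phi>_const by blast
  then show ?thesis
    unfolding f
    by (intro conjI exI[of _ "range P.\<phi>"] P.petit.unital_division_algebra_axioms P.petit_fin_dim
        P.petit_dim P.left_nucleus_petit P.middle_nucleus_petit P.constant_polys_right_nucleus
        P.subgroup_range_\<phi> P.cyclic_range_\<phi> P.card_range_\<phi>)
qed

end
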